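(* For every tree $T$ as in the context, the shard intersection order $\Psi(\mathrm{Bic}(T))$ is a lattice.
   Context: Let $T$ be a finite tree embedded in a disk so that exactly its leaves lie on the boundary, with every non-leaf vertex of degree at least $3$; the embedding gives a cyclic order of edges at each vertex. A segment is an acyclic path $(v_1,\dots,v_n)$, $n\ge2$, of pairwise distinct consecutive-adjacent vertices such that for each $1\le j\le n-2$ the edge $\{v_{j+1},v_{j+2}\}$ is immediately clockwise or counterclockwise from $\{v_j,v_{j+1}\}$ at $v_{j+1}$; $\mathrm{Seg}(T)$ is the set of segments. For segments $s_1=(v_1,\dots,v_k)$, $s_2=(v_k,\dots,v_n)$ sharing only $v_k$, $s_1\circ s_2=(v_1,\dots,v_n)$; they are composable if this is a segment. $B\subseteq\mathrm{Seg}(T)$ is closed if it contains $s_1\circ s_2$ for all composable $s_1,s_2\in B$, biclosed if $B$ and its complement are closed. $\mathrm{Bic}(T)$ is the lattice of biclosed sets under inclusion; its covering relations are exactly pairs $(B',B'\sqcup\{s\})$ of biclosed sets. A split of a segment $t$ is a proper subsegment of $t$ sharing an endpoint with $t$; a break of $[a,c]$ is a pair $\{[a,b],[b,c]\}$ with $b$ a vertex of $[a,c]$ strictly between $a$ and $c$. $\mathcal{S}_T$ is the set of labels $s_{\mathcal{D}}=(s,\mathcal{D})$ with $s$ having $m$ breaks and $\mathcal{D}$ a set of $m$ splits of $s$ no two in the same break; $\widetilde{\lambda}(B',B'\sqcup\{s\})=s_{\mathcal{D}}$ with $\mathcal{D}$ the set of splits of $s$ in $B'$. For $B\in\mathrm{Bic}(T)$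 with $B_1,\dots,B_k$ the elements covered by $B$, $\psi(B):=\{\widetilde\lambda(W,Z): \bigwedge_{i=1}^k B_i\le W\lessdot Z\le B\}$ (empty if $B=\emptyset$). The shard intersection order $\Psi(\mathrm{Bic}(T))$ is the set $\{\psi(B):B\in\mathrm{Bic}(T)\}$ partially ordered by inclusion. *)

theory Defs
  imports "HOL-Algebra.Lattice" "HOL-Combinatorics.Orbits"
begin

text \<open>
  A tree embedded in a disk with its leaves on the boundary is represented by its combinatorial
  data: vertices, edges (two-element vertex sets), and the cyclic order of the edges around each
  vertex. Writing an edge at \<open>v\<close> as its other endpoint, \<open>cw T v u\<close> is the neighbour \<open>w\<close> of \<open>v\<close>
  such that \<open>{v, w}\<close> is immediately clockwise from \<open>{v, u}\<close> at \<open>v\<close>. Every choice of cyclic orders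
  on a finite tree arises from such an embedding.
\<close>

record 'a ptree =
  verts :: "'a set"
  edges :: "'a set set"
  cw :: "'a \<Rightarrow> 'a \<Rightarrow> 'a"

definition nbrs :: "('a, 'b) ptree_scheme \<Rightarrow> 'a \<Rightarrow> 'a set" where
  "nbrs T v = {w. {v, w} \<in> edges T}"

definition walk :: "('a, 'b) ptree_scheme \<Rightarrow> 'a list \<Rightarrow> bool" where
  "walk T xs \<longleftrightarrow> xs \<noteq> [] \<and> set xs \<subseteq> verts T \<and> successively (\<lambda>u v. {u, v} \<in> edges T) xs"

locale embedded_tree =
  fixes T :: "('a, 'b) ptree_scheme"
  assumes finite_verts: "finite (verts T)"
    and nonempty: "verts T \<noteq> {}"
    and simple: "\<And>e. e \<in> edges T \<Longrightarrow> e \<subseteq> verts T \<and> card e = 2"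
    and connected: "\<And>u v. u \<in> verts T \<Longrightarrow> v \<in> verts T \<Longrightarrow>
      \<exists>xs. walk T xs \<and> hd xs = u \<and> last xs = v"
    and acyclic: "\<And>xs. walk T xs \<Longrightarrow> distinct xs \<Longrightarrow> 3 \<le> length xs \<Longrightarrow> {last xs, hd xs} \<notin> edges T"
    and degree: "\<And>v. v \<in> verts T \<Longrightarrow> card (nbrs T v) \<noteq> 1 \<Longrightarrow> 3 \<le> card (nbrs T v)"
    and rotation: "\<And>v. v \<in> verts T \<Longrightarrow> cyclic_on (cw T v) (nbrs T v)"

definition seg_path :: "('a, 'b) ptree_scheme \<Rightarrow> 'a list \<Rightarrow> bool" where
  "seg_path T xs \<longleftrightarrow> 2 \<le> length xs \<and> walk T xs \<and> distinct xs \<and>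
    (\<forall>j. j + 2 < length xs \<longrightarrow>
      xs ! (j + 2) = cw T (xs ! (j + 1)) (xs ! j) \<or>
      xs ! j = cw T (xs ! (j + 1)) (xs ! (j + 2)))"

text \<open>
  A segment does not depend on the direction in which it is traversed. Since a path in a tree is
  determined, up to reversal, by its set of vertices, segments are identified with their vertex sets.
\<close>

definition Seg :: "('a, 'b) ptree_scheme \<Rightarrow> 'a set set" where
  "Seg T = {set xs | xs. seg_path T xs}"

text \<open>The composite of composable segments \<open>s1\<close> and \<open>s2\<close> has vertex set \<open>s1 \<union> s2\<close>.\<close>

definition composable :: "('a, 'b) ptree_scheme \<Rightarrow> 'a set \<Rightarrow> 'a set \<Rightarrow> bool" where
  "composable T s1 s2 \<longleftrightarrow> (\<exists>p v q.
    seg_path T (p @ [v]) \<and> seg_path T (v # q) \<and> seg_path T (p @ v # q) \<and>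
    s1 = set (p @ [v]) \<and> s2 = set (v # q))"

definition closed_segs :: "('a, 'b) ptree_scheme \<Rightarrow> 'a set set \<Rightarrow> bool" where
  "closed_segs T B \<longleftrightarrow> (\<forall>s1\<in>B. \<forall>s2\<in>B. composable T s1 s2 \<longrightarrow> s1 \<union> s2 \<in> B)"

definition Bic :: "('a, 'b) ptree_scheme \<Rightarrow> 'a set set set" where
  "Bic T = {B. B \<subseteq> Seg T \<and> closed_segs T B \<and> closed_segs T (Seg T - B)}"

definition inclusion_order :: "'c set set \<Rightarrow> 'c set gorder" where
  "inclusion_order C = \<lparr>carrier = C, eq = (=), le = (\<subseteq>)\<rparr>"

definition bic_covers :: "('a, 'b) ptree_scheme \<Rightarrow> 'a set set \<Rightarrow> 'a set set \<Rightarrow> bool" where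
  "bic_covers T W Z \<longleftrightarrow> W \<in> Bic T \<and> Z \<in> Bic T \<and> W \<subset> Z \<and> \<not> (\<exists>V\<in>Bic T. W \<subset> V \<and> V \<subset> Z)"

definition endpoints :: "('a, 'b) ptree_scheme \<Rightarrow> 'a set \<Rightarrow> 'a set" where
  "endpoints T s = (\<Union>xs\<in>{xs. seg_path T xs \<and> set xs = s}. {hd xs, last xs})"

definition splits :: "('a, 'b) ptree_scheme \<Rightarrow> 'a set \<Rightarrow> 'a set set" where
  "splits T t = {s \<in> Seg T. s \<subset> t \<and> endpoints T s \<inter> endpoints T t \<noteq> {}}"

text \<open>
  The label of a cover \<open>W \<subset> Z\<close>, for which \<open>Z - W\<close> is a singleton: the element of \<open>Z - W\<close>,
  paired with the set of its splits in \<open>W\<close>.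
\<close>

definition cover_label ::
    "('a, 'b) ptree_scheme \<Rightarrow> 'a set set \<Rightarrow> 'a set set \<Rightarrow> 'a set \<times> 'a set set" where
  "cover_label T W Z = (let s = the_elem (Z - W) in (s, splits T s \<inter> W))"

definition psi :: "('a, 'b) ptree_scheme \<Rightarrow> 'a set set \<Rightarrow> ('a set \<times> 'a set set) set" where
  "psi T B = (if B = {} then {} else
    {cover_label T W Z | W Z.
      \<Sqinter>\<^bsub>inclusion_order (Bic T)\<^esub> {B'. bic_covers T B' B} \<subseteq> W \<and> bic_covers T W Z \<and> Z \<subseteq> B})"

definition shard_intersection_order ::
    "('a, 'b) ptree_scheme \<Rightarrow> ('a set \<times> 'a set set) set gorder" where
  "shard_intersection_order T = inclusion_order (psi T ` Bic T)"

end

theory Submission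
  imports Defs
begin

text \<open>
  A descent of a biclosed set \<open>B\<close> is a segment \<open>s \<in> B\<close> such that \<open>B - {s}\<close> is biclosed. Let \<open>C(B)\<close> be
  the set of all composites of descents of \<open>B\<close>. The meet of the elements covered by \<open>B\<close> is
  \<open>B - C(B)\<close>, and \<open>\<psi>(B)\<close> consists of all labels \<open>(s, D)\<close> with \<open>s \<in> C(B)\<close> and \<open>D \<subseteq> B\<close>.

  These sets are closed under intersection. Given \<open>B\<^sub>1\<close> and \<open>B\<^sub>2\<close>, put \<open>N = B\<^sub>1 \<inter> B\<^sub>2\<close> and let \<open>A\<close> be the
  set of those \<open>s \<in> C(B\<^sub>1) \<inter> C(B\<^sub>2)\<close> for which every break has a member in \<open>N\<close>. Each \<open>s = [a, b]\<close>
  that is indecomposable in \<open>A\<close> yields the biclosed set of all \<open>[x, y] \<subseteq> [a, b]\<close> with \<open>x = a\<close> or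
  \<open>[x, b] \<in> N\<close>, and \<open>y = b\<close> or \<open>[a, y] \<in> N\<close>. The closure \<open>B\<close> of the union of these sets is biclosed, its
  descents are the indecomposable elements of \<open>A\<close>, and \<open>\<psi>(B) = \<psi>(B\<^sub>1) \<inter> \<psi>(B\<^sub>2)\<close>. Since \<open>\<psi>(Seg(T))\<close>
  is the largest element, the finite poset of all \<open>\<psi>(B)\<close> is a lattice.
\<close>

subsection \<open>Biclosed relations\<close>

text \<open>
  A segment is encoded by its ordered pair of endpoints, and \<open>btw a v b\<close> says that \<open>[a, b]\<close> is a
  segment with \<open>v\<close> strictly inside. A set of segments becomes a symmetric relation.
\<close>

locale betweenness =
  fixes seg :: "'a \<Rightarrow> 'a \<Rightarrow> bool" and btw :: "'a \<Rightarrow> 'a \<Rightarrow> 'a \<Rightarrow> bool"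
  assumes seg_irrefl: "\<not> seg a a"
    and seg_sym: "seg a b \<Longrightarrow> seg b a"
    and btw_sym: "btw a v b \<Longrightarrow> btw b v a"
    and btw_seg: "btw a v b \<Longrightarrow> seg a b"
    and btw_seg_left: "btw a v b \<Longrightarrow> seg a v"
    and btw_initial: "btw a v b \<Longrightarrow> btw a w v \<Longrightarrow> btw a w b"
    and btw_middle: "btw a v b \<Longrightarrow> btw a w v \<Longrightarrow> btw w v b"
    and btw_linear: "btw a v b \<Longrightarrow> btw a w b \<Longrightarrow> v = w \<or> btw a v w \<or> btw a w v"
    and finite_btw: "finite {v. \<exists>a b. btw a v b}"
begin

section \<open>Order of the vertices on a segment\<close>

lemma btw_seg_right: "btw a v b \<Longrightarrow> seg v b"
  using btw_seg_left btw_sym seg_sym by blast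

lemma btw_distinct:
  assumes "btw a v b" shows "a \<noteq> v" "v \<noteq> b" "a \<noteq> b"
  using assms btw_seg btw_seg_left btw_seg_right seg_irrefl by blast+

lemma btw_final: "btw a v b \<Longrightarrow> btw v w b \<Longrightarrow> btw a w b"
  using btw_initial btw_sym by blast

lemma btw_middle': "btw a v b \<Longrightarrow> btw v w b \<Longrightarrow> btw a v w"
  using btw_middle btw_sym by blast

lemma btw_asym: "btw a v b \<Longrightarrow> \<not> btw a b v"
  using btw_middle btw_distinct by blast

lemma btw_cases:
  assumes "btw a v b" "btw a w b"
  obtains "w = v" | "btw a w v" "btw w v b" | "btw a v w" "btw v w b"
  using assms btw_linear btw_middle by blast

definition len :: "'a \<Rightarrow> 'a \<Rightarrow> nat" where
  "len a b = card {v. btw a v b}"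

lemma finite_btw': "finite {v. btw a v b}"
  by (rule finite_subset[OF _ finite_btw]) blast

lemma len_initial: "btw a v b \<Longrightarrow> len a v < len a b"
  unfolding len_def
  by (intro psubset_card_mono finite_btw') (use btw_initial btw_distinct in blast)

lemma len_sym: "len a b = len b a"
  unfolding len_def using btw_sym by (intro arg_cong[where f = card]) blast

lemma len_final: "btw a v b \<Longrightarrow> len v b < len a b"
  using len_initial[OF btw_sym] len_sym by metis

lemma len_le: "len a b \<le> card {v. \<exists>a b. btw a v b}"
  unfolding len_def by (intro card_mono finite_btw) blast

section \<open>Biclosed relations and descents\<close>

definition closed_rel :: "('a \<Rightarrow> 'a \<Rightarrow> bool) \<Rightarrow> bool" where
  "closed_rel R \<longleftrightarrow> (\<forall>a v b. btw a v b \<longrightarrow> R a v \<longrightarrow> R v b \<longrightarrow> R a b)"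

definition coclosed_rel :: "('a \<Rightarrow> 'a \<Rightarrow> bool) \<Rightarrow> bool" where
  "coclosed_rel R \<longleftrightarrow> (\<forall>a v b. btw a v b \<longrightarrow> R a b \<longrightarrow> R a v \<or> R v b)"

definition seg_rel :: "('a \<Rightarrow> 'a \<Rightarrow> bool) \<Rightarrow> bool" where
  "seg_rel R \<longleftrightarrow> symp R \<and> R \<le> seg"

definition biclosed :: "('a \<Rightarrow> 'a \<Rightarrow> bool) \<Rightarrow> bool" where
  "biclosed R \<longleftrightarrow> seg_rel R \<and> closed_rel R \<and> coclosed_rel R"

definition indec :: "('a \<Rightarrow> 'a \<Rightarrow> bool) \<Rightarrow> 'a \<Rightarrow> 'a \<Rightarrow> bool" where
  "indec R a b \<longleftrightarrow> R a b \<and> (\<forall>v. btw a v b \<longrightarrow> R a v \<longrightarrow> \<not> R v b)"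

text \<open>Local form of the condition that removing \<open>[a, b]\<close> keeps \<open>R\<close>
  biclosed: indecomposability preserves closure, and the two cancellation conditions preserve
  coclosure. The equivalence is \<open>descent_iff_biclosed_remove\<close>.\<close>

definition descent :: "('a \<Rightarrow> 'a \<Rightarrow> bool) \<Rightarrow> 'a \<Rightarrow> 'a \<Rightarrow> bool" where
  "descent R a b \<longleftrightarrow> indec R a b \<and>
    (\<forall>c. btw a b c \<longrightarrow> R a c \<longrightarrow> R b c) \<and> (\<forall>c. btw c a b \<longrightarrow> R c b \<longrightarrow> R c a)"

lemma closedD: "closed_rel R \<Longrightarrow> btw a v b \<Longrightarrow> R a v \<Longrightarrow> R v b \<Longrightarrow> R a b"
  unfolding closed_rel_def by blast

lemma coclosedD: "coclosed_rel R \<Longrightarrow> btw a v b \<Longrightarrow> R a b \<Longrightarrow> R a v \<or> R v b"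
  unfolding coclosed_rel_def by blast

lemma seg_relD: "seg_rel R \<Longrightarrow> R a b \<Longrightarrow> R b a" "seg_rel R \<Longrightarrow> R a b \<Longrightarrow> seg a b"
  unfolding seg_rel_def by (auto dest: sympD)

lemma biclosedD:
  assumes "biclosed R" shows "seg_rel R" "closed_rel R" "coclosed_rel R"
  using assms unfolding biclosed_def by auto

lemma indec_sym: "seg_rel R \<Longrightarrow> indec R a b \<Longrightarrow> indec R b a"
  unfolding indec_def using btw_sym seg_relD(1) by blast

lemma descent_sym: "seg_rel R \<Longrightarrow> descent R a b \<Longrightarrow> descent R b a"
  unfolding descent_def by (meson indec_sym btw_sym seg_relD(1))

section \<open>Closure under composition\<close>

inductive cl :: "('a \<Rightarrow> 'a \<Rightarrow> bool) \<Rightarrow> 'a \<Rightarrow> 'a \<Rightarrow> bool" for R where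
  base: "R a b \<Longrightarrow> cl R a b"
| comp: "btw a v b \<Longrightarrow> cl R a v \<Longrightarrow> cl R v b \<Longrightarrow> cl R a b"

lemma cl_closed: "closed_rel (cl R)"
  unfolding closed_rel_def by (blast intro: cl.comp)

lemma cl_least: "cl R a b \<Longrightarrow> R \<le> R' \<Longrightarrow> closed_rel R' \<Longrightarrow> R' a b"
  by (induction rule: cl.induct) (blast dest: closedD)+

lemma seg_rel_cl:
  assumes "seg_rel R" shows "seg_rel (cl R)"
proof -
  have "cl R a b \<Longrightarrow> cl R b a \<and> seg a b" for a b
    by (induction rule: cl.induct)
      (use assms in \<open>blast intro: cl.base cl.comp btw_sym btw_seg dest: seg_relD\<close>)+
  then show ?thesis unfolding seg_rel_def by (blast intro: sympI)
qed

text \<open>If a composite at \<open>w\<close> is broken at \<open>v\<close>, then \<open>v\<close>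
  equals \<open>w\<close> or lies inside one factor. By induction one piece of that factor is in the
  closure, and a piece ending at \<open>w\<close> is completed by the other factor.\<close>

lemma cl_coclosed:
  assumes "coclosed_rel R" shows "coclosed_rel (cl R)"
proof -
  have "cl R a b \<Longrightarrow> btw a v b \<Longrightarrow> cl R a v \<or> cl R v b" for a v b
  proof (induction arbitrary: v rule: cl.induct)
    case (base a b)
    then show ?case using assms by (blast intro: cl.base dest: coclosedD)
  next
    case (comp a w b)
    show ?case
      using btw_cases[OF comp.hyps(1) comp.prems] comp by (metis cl.comp)
  qed
  then show ?thesis unfolding coclosed_rel_def by blast
qed

lemma cl_indec:
  assumes "R a b" "R \<le> seg" shows "cl (indec R) a b"
  using assms(1)
proof (induction "len a b" arbitrary: a b rule: less_induct)
  case less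
  show ?case
  proof (cases "indec R a b")
    case False
    then obtain v where "btw a v b" "R a v" "R v b" using less.prems unfolding indec_def by blast
    then show ?thesis using less.hyps len_initial len_final by (blast intro: cl.comp)
  qed (rule cl.base)
qed

section \<open>Existence of descents\<close>

text \<open>The indecomposable members of \<open>Z\<close> generate \<open>Z\<close>, so a closed
  \<open>W\<close> containing all of them would contain \<open>Z\<close>. A longest one outside
  \<open>W\<close> exists because \<open>len\<close> is bounded.\<close>

lemma exists_max_indec:
  assumes Z: "biclosed Z" and W: "closed_rel W" and ab: "Z a b" "\<not> W a b"
  obtains a b where "indec Z a b" "\<not> W a b"
    "\<And>c d. indec Z c d \<Longrightarrow> \<not> W c d \<Longrightarrow> len c d \<le> len a b"
proof -
  have "\<exists>a b. indec Z a b \<and> \<not> W a b"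
  proof (rule ccontr)
    assume "\<nexists>a b. indec Z a b \<and> \<not> W a b"
    then have "indec Z \<le> W" by blast
    moreover have "cl (indec Z) a b"
      using cl_indec[of Z, OF ab(1)] Z unfolding biclosed_def seg_rel_def by blast
    ultimately show False using cl_least W ab(2) by blast
  qed
  moreover define P where "P n \<longleftrightarrow> (\<exists>a b. indec Z a b \<and> \<not> W a b \<and> len a b = n)" for n
  ultimately have "\<exists>n. P n" by blast
  moreover have "\<And>n. P n \<Longrightarrow> n \<le> card {v. \<exists>a b. btw a v b}"
    unfolding P_def using len_le by blast
  ultimately obtain n where "P n" "\<And>m. P m \<Longrightarrow> m \<le> n"
    by (metis GreatestI_nat Greatest_le_nat)
  then show thesis unfolding P_def using that by blast
qed

text \<open>If the conclusion failed, a shortest violating \<open>[a, c]\<close> would itself be indecomposable.\<close>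

lemma max_indec_right:
  assumes Z: "biclosed Z" and W: "biclosed W" "W \<le> Z"
    and ab: "indec Z a b" "\<not> W a b"
    and max: "\<And>c d. indec Z c d \<Longrightarrow> \<not> W c d \<Longrightarrow> len c d \<le> len a b"
    and c: "btw a b c" "Z a c"
  shows "Z b c"
  using c
proof (induction "len b c" arbitrary: c rule: less_induct)
  case less
  note Zc = biclosedD(2)[OF Z] and Zo = biclosedD(3)[OF Z]
  show ?case
  proof (rule ccontr)
    assume nZ: "\<not> Z b c"
    have "\<not> W a c" using coclosedD[OF biclosedD(3)[OF W(1)] less.prems(1)] ab(2) nZ W(2) by blast
    moreover have "\<not> (Z a p \<and> Z p c)" if p: "btw a p c" for p
      using less.prems(1) p
    proof (cases rule: btw_cases)
      case 2
      then show ?thesis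
        using coclosedD[OF Zo, of p b c] ab(1) nZ unfolding indec_def by blast
    next
      case 3
      then show ?thesis
        using less.hyps[OF len_initial] closedD[OF Zc, of b p c] nZ by blast
    qed (use nZ in blast)
    ultimately have "len a c \<le> len a b" using max less.prems(2) unfolding indec_def by blast
    then show False using len_initial[OF less.prems(1)] by simp
  qed
qed

text \<open>A longest indecomposable member of \<open>Z\<close> outside \<open>W\<close> is a
  descent: \<open>max_indec_right\<close> gives one cancellation condition, and the other comes from
  applying it to the reversed segment. This is what forces covers to differ by a single
  segment.\<close>

lemma exists_descent:
  assumes Z: "biclosed Z" and W: "biclosed W" "W \<le> Z" and ab: "Z a b" "\<not> W a b"
  obtains a b where "descent Z a b" "\<not> W a b"
proof -
  obtain a b where m: "indec Z a b" "\<not> W a b"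
    "\<And>c d. indec Z c d \<Longrightarrow> \<not> W c d \<Longrightarrow> len c d \<le> len a b"
    using exists_max_indec[OF Z biclosedD(2)[OF W(1)] ab] by blast
  have m': "indec Z b a" "\<not> W b a" "\<And>c d. indec Z c d \<Longrightarrow> \<not> W c d \<Longrightarrow> len c d \<le> len b a"
    using m indec_sym[OF biclosedD(1)[OF Z]] seg_relD(1)[OF biclosedD(1)[OF W(1)]] len_sym[of a b]
    by auto
  have "descent Z a b"
    unfolding descent_def
    using m(1) max_indec_right[OF Z W m] max_indec_right[OF Z W m'] btw_sym
      seg_relD(1)[OF biclosedD(1)[OF Z]] by blast
  then show thesis using that m(2) by blast
qed

definition remove :: "('a \<Rightarrow> 'a \<Rightarrow> bool) \<Rightarrow> 'a \<Rightarrow> 'a \<Rightarrow> 'a \<Rightarrow> 'a \<Rightarrow> bool" where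
  "remove R a b x y \<longleftrightarrow> R x y \<and> \<not> (x = a \<and> y = b) \<and> \<not> (x = b \<and> y = a)"

lemma descent_iff_biclosed_remove:
  assumes B: "biclosed B" and ab: "B a b"
  shows "descent B a b \<longleftrightarrow> biclosed (remove B a b)"
proof
  note S = biclosedD(1)[OF B] and Bc = biclosedD(2)[OF B] and Bo = biclosedD(3)[OF B]
  assume d: "descent B a b"
  note d' = descent_sym[OF S d]
  have "seg_rel (remove B a b)"
    using S unfolding seg_rel_def remove_def symp_def by auto
  moreover have "closed_rel (remove B a b)"
    unfolding closed_rel_def remove_def
    using closedD[OF Bc] d d' unfolding descent_def indec_def by metis
  moreover have "coclosed_rel (remove B a b)"
    unfolding coclosed_rel_def
  proof (intro allI impI)
    fix x v y assume v: "btw x v y" and "remove B a b x y"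
    then have xy: "B x y" "\<not> (x = a \<and> y = b)" "\<not> (x = b \<and> y = a)" by (auto simp: remove_def)
    \<comment> \<open>Coclosure can only fail where one piece of the break is the removed segment.
      In each of the four positions, cancellation of the descent supplies the other piece.\<close>
    have "B v y" if "x = a" "v = b" using d v xy that unfolding descent_def by blast
    moreover have "B v y" if "x = b" "v = a" using d' v xy that unfolding descent_def by blast
    moreover have "B x v" if "v = a" "y = b" using d v xy that unfolding descent_def by blast
    moreover have "B x v" if "v = b" "y = a" using d' v xy that unfolding descent_def by blast
    moreover have "B x v \<or> B v y" using coclosedD[OF Bo v xy(1)] .
    ultimately show "remove B a b x v \<or> remove B a b v y"
      unfolding remove_def using btw_distinct[OF v] xy by metis
  qed
  ultimately show "biclosed (remove B a b)" unfolding biclosed_def by blast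
next
  assume R: "biclosed (remove B a b)"
  note Rc = biclosedD(2)[OF R] and Ro = biclosedD(3)[OF R]
  show "descent B a b"
    unfolding descent_def indec_def
  proof (intro conjI allI impI ab notI)
    fix v assume v: "btw a v b" "B a v" "B v b"
    then have "remove B a b a v" "remove B a b v b" using btw_distinct by (auto simp: remove_def)
    then show False using closedD[OF Rc v(1)] by (auto simp: remove_def)
  next
    fix c assume c: "btw a b c" "B a c"
    then have "remove B a b a c" using btw_distinct[OF c(1)] by (auto simp: remove_def)
    then show "B b c" using coclosedD[OF Ro c(1)] by (auto simp: remove_def)
  next
    fix c assume c: "btw c a b" "B c b"
    then have "remove B a b c b" using btw_distinct[OF c(1)] by (auto simp: remove_def)
    then show "B c a" using coclosedD[OF Ro c(1)] by (auto simp: remove_def)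
  qed
qed

section \<open>Composites of descents and the meet of the lower covers\<close>

abbreviation dcl :: "('a \<Rightarrow> 'a \<Rightarrow> bool) \<Rightarrow> 'a \<Rightarrow> 'a \<Rightarrow> bool" where
  "dcl B \<equiv> cl (descent B)"

lemma descents_le: "descent B \<le> B"
  unfolding descent_def indec_def by blast

lemma seg_rel_dcl: "seg_rel B \<Longrightarrow> seg_rel (dcl B)"
  by (rule seg_rel_cl)
    (unfold seg_rel_def[of "descent B"], blast intro: sympI descent_sym dest: seg_relD
      descents_le[THEN predicate2D])

lemma dcl_le: "biclosed B \<Longrightarrow> dcl B a b \<Longrightarrow> B a b"
  using cl_least descents_le biclosedD(2) by blast

text \<open>A descent cancels by definition, and a composite is cancelled one factor at a
  time.\<close>

lemma dcl_cancel_left: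
  "dcl B a v \<Longrightarrow> btw a v b \<Longrightarrow> B a b \<Longrightarrow> B v b"
proof (induction arbitrary: b rule: cl.induct)
  case (base a v)
  then show ?case unfolding descent_def by blast
next
  case (comp a w v)
  then show ?case using btw_initial btw_middle by blast
qed

lemma dcl_cancel_right:
  "biclosed B \<Longrightarrow> dcl B v b \<Longrightarrow> btw a v b \<Longrightarrow> B a b \<Longrightarrow> B a v"
  using dcl_cancel_left[of B b v a] btw_sym seg_relD(1)[OF biclosedD(1)]
    seg_relD(1)[OF seg_rel_dcl[OF biclosedD(1)]] by blast

text \<open>If a composite at \<open>w\<close> is broken at \<open>v\<close>, cancelling the factor
  not containing \<open>v\<close> puts the segment between \<open>v\<close> and \<open>w\<close>
  into \<open>B\<close>. The induction hypothesis then applies to the factor that \<open>v\<close>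
  breaks.\<close>

lemma dcl_break:
  assumes B: "biclosed B"
  shows "dcl B a b \<Longrightarrow> btw a v b \<Longrightarrow> B a v \<Longrightarrow> B v b \<Longrightarrow> dcl B a v \<and> dcl B v b"
proof (induction arbitrary: v rule: cl.induct)
  case (base a b)
  then show ?case unfolding descent_def indec_def by blast
next
  case (comp a w b)
  show ?case using comp.hyps(1) comp.prems(1)
  proof (cases rule: btw_cases)
    case 1
    then show ?thesis using comp by blast
  next
    case 2
    then have "B v w" using dcl_cancel_right[OF B] comp by blast
    then show ?thesis using 2 comp by (blast intro: cl.comp)
  next
    case 3
    then have "B w v" using dcl_cancel_left comp by blast
    then show ?thesis using 3 comp by (blast intro: cl.comp)
  qed
qed

text \<open>For nonempty \<open>B\<close> this is the meet of the elements covered by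
  \<open>B\<close>; see \<open>inf_covers\<close>.\<close>

definition dcl_compl :: "('a \<Rightarrow> 'a \<Rightarrow> bool) \<Rightarrow> 'a \<Rightarrow> 'a \<Rightarrow> bool" where
  "dcl_compl B a b \<longleftrightarrow> B a b \<and> \<not> dcl B a b"

text \<open>Closure is \<open>dcl_break\<close>. For coclosure, if one piece of a break is a
  composite of descents, cancellation puts the other piece into \<open>B\<close>, and that one
  cannot be such a composite as well.\<close>

lemma biclosed_dcl_compl:
  assumes B: "biclosed B" shows "biclosed (dcl_compl B)"
proof -
  note S = biclosedD(1)[OF B] and Bc = biclosedD(2)[OF B] and Bo = biclosedD(3)[OF B]
  have "seg_rel (dcl_compl B)"
    using S seg_rel_dcl[OF S] unfolding seg_rel_def dcl_compl_def symp_def by blast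
  moreover have "closed_rel (dcl_compl B)"
    unfolding closed_rel_def dcl_compl_def using closedD[OF Bc] dcl_break[OF B] by blast
  moreover have "coclosed_rel (dcl_compl B)"
    unfolding coclosed_rel_def dcl_compl_def
    by (metis dcl_cancel_left dcl_cancel_right[OF B] coclosedD[OF Bo] cl.comp)
  ultimately show ?thesis unfolding biclosed_def by blast
qed

text \<open>Coclosure of \<open>W\<close> says that its complement is closed, so a \<open>W\<close>
  avoiding the descents avoids all their composites.\<close>

lemma dcl_compl_greatest:
  assumes W: "biclosed W" "W \<le> B" and d: "\<And>a b. descent B a b \<Longrightarrow> \<not> W a b"
  shows "W \<le> dcl_compl B"
proof -
  have "dcl B a b \<Longrightarrow> \<not> W a b" for a b
    by (induction rule: cl.induct) (use d coclosedD[OF biclosedD(3)[OF W(1)]] in blast)+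
  then show ?thesis using W(2) unfolding dcl_compl_def by blast
qed

text \<open>\<open>[x, y]\<close> is a subsegment of \<open>[a, b]\<close> with \<open>x\<close> on the side of \<open>a\<close>.\<close>

definition bef :: "'a \<Rightarrow> 'a \<Rightarrow> 'a \<Rightarrow> 'a \<Rightarrow> bool" where
  "bef a b x y \<longleftrightarrow> seg a b \<and>
    (x = a \<and> (y = b \<or> btw a y b) \<or> btw a x b \<and> (y = b \<or> btw x y b))"

lemma bef_sym: "bef a b x y \<Longrightarrow> bef b a y x"
  unfolding bef_def by (metis btw_sym seg_sym btw_final btw_middle')

lemma bef_seg: "bef a b x y \<Longrightarrow> seg x y"
  unfolding bef_def using btw_seg_left btw_seg_right by blast

lemma bef_split:
  assumes "bef a b x z" and y: "btw x y z" shows "bef a b x y" "bef a b y z" "btw a y b"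
proof -
  have s: "seg a b" using assms(1) unfolding bef_def by blast
  consider "x = a" "z = b" | "x = a" "btw a z b" | "btw a x b" "z = b" | "btw a x b" "btw x z b"
    using assms(1) unfolding bef_def by blast
  then have "bef a b x y \<and> bef a b y z \<and> btw a y b"
  proof cases
    case 2
    then show ?thesis using y s btw_initial[of a z b y] btw_middle[of a z b y]
      unfolding bef_def by blast
  next
    case 3
    then show ?thesis using y s btw_final[of a x b y] unfolding bef_def by blast
  next
    case 4
    then have "btw x y b" "btw y z b" using y btw_initial btw_middle by blast+
    then show ?thesis using 4 s btw_final[of a x b y] unfolding bef_def by blast
  qed (use y s in \<open>auto simp: bef_def\<close>)
  then show "bef a b x y" "bef a b y z" "btw a y b" by auto
qed

lemma bef_not_last: "\<not> bef a b b y"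
  unfolding bef_def using btw_distinct seg_irrefl btw_asym by metis

lemma bef_not_first: "\<not> bef a b x a"
  using bef_not_last bef_sym by blast

text \<open>Both \<open>y\<close> and \<open>z\<close> lie on the side of \<open>b\<close> as seen
  from \<open>x\<close>.\<close>

lemma bef_linear:
  assumes "bef a b x y" "bef a b x z" shows "\<not> btw y x z"
proof
  assume x: "btw y x z"
  have "y = b \<or> btw x y b" "z = b \<or> btw x z b" using assms unfolding bef_def by blast+
  then have "btw x y z \<or> btw x z y" using btw_linear[of x y b z] btw_distinct(3)[OF x] by blast
  then show False using x btw_asym btw_sym by blast
qed

section \<open>Covers with a prescribed label\<close>

text \<open>\<open>L\<close> encodes the splits of the label: it consists of the vertices
  \<open>v\<close> at which the piece \<open>[a, v]\<close> is chosen, while \<open>[v, b]\<close>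
  is chosen elsewhere.\<close>

lemma exists_cover_with_label:
  assumes B: "biclosed B" and ab: "dcl B a b"
    and L: "\<And>v. btw a v b \<Longrightarrow> if v \<in> L then B a v else B v b"
  obtains Z where "biclosed Z" "dcl_compl B \<le> Z" "Z \<le> B" "descent Z a b"
    "\<And>v. btw a v b \<Longrightarrow> (Z a v \<longleftrightarrow> v \<in> L) \<and> (Z v b \<longleftrightarrow> v \<notin> L)"
proof -
  note S = biclosedD(1)[OF B] and Bc = biclosedD(2)[OF B] and Bo = biclosedD(3)[OF B]
  note BM = biclosed_dcl_compl[OF B]
  have CB: "\<And>x y. dcl B x y \<Longrightarrow> B x y" using dcl_le[OF B] .
  have dcl_sym: "\<And>x y. dcl B x y \<Longrightarrow> dcl B y x" using seg_relD(1)[OF seg_rel_dcl[OF S]] .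
  have sab: "seg a b" using CB[OF ab] seg_relD(2)[OF S] by blast
  \<comment> \<open>These are the segments added to the meet. A left end other than \<open>a\<close>
    avoids \<open>L\<close> and a right end other than \<open>b\<close> belongs to \<open>L\<close>,
    so the splits of \<open>[a, b]\<close> in \<open>X\<close> are among the chosen ones.\<close>
  define X where "X x y \<longleftrightarrow> bef a b x y \<and> dcl B x y \<and> (x = a \<or> x \<notin> L) \<and> (y = b \<or> y \<in> L)" for x y
  define Z where "Z x y \<longleftrightarrow> dcl_compl B x y \<or> X x y \<or> X y x" for x y
  have XC: "\<And>x y. X x y \<Longrightarrow> dcl B x y \<and> dcl B y x" unfolding X_def using dcl_sym by blast
  \<comment> \<open>A common vertex would be the right end of one member, hence in \<open>L\<close>,
    and the left end of the other, hence outside \<open>L\<close>. So no two members of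
    \<open>X\<close> compose.\<close>
  have XX: "\<not> X y z" if "X x y" for x y z
    using that bef_not_last bef_not_first unfolding X_def by blast
  have Z_le: "Z \<le> B" unfolding Z_def dcl_compl_def using XC CB by blast
  have Z_seg: "seg_rel Z"
    using Z_le S seg_relD(1)[OF biclosedD(1)[OF BM]] unfolding seg_rel_def symp_def Z_def by blast
  \<comment> \<open>If a factor lies in the meet, then by \<open>dcl_break\<close> so does the
    composite. Two factors from \<open>X\<close> either contradict \<open>XX\<close> or point in the
    same direction from \<open>y\<close>.\<close>
  have Z_closed: "Z x z" if v: "btw x y z" and xy: "Z x y" and yz: "Z y z" for x y z
  proof (cases "dcl_compl B x y \<or> dcl_compl B y z")
    case True
    have "B x z" using closedD[OF Bc v] Z_le xy yz by blast
    moreover have "\<not> dcl B x z" using True dcl_break[OF B _ v] Z_le xy yz unfolding dcl_compl_def by blast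
    ultimately show ?thesis unfolding Z_def dcl_compl_def by blast
  next
    case False
    then consider "X x y" "X y z" | "X x y" "X z y" | "X y x" "X y z" | "X y x" "X z y"
      using xy yz unfolding Z_def by blast
    then have False
    proof cases
      case 2
      then show ?thesis using bef_linear[of b a y x z] bef_sym v unfolding X_def by blast
    next
      case 3
      then show ?thesis using bef_linear[of a b y x z] v unfolding X_def by blast
    qed (use XX in blast)+
    then show ?thesis ..
  qed
  \<comment> \<open>When both pieces lie in \<open>B\<close>, both are composites of descents, and
    membership of \<open>y\<close> in \<open>L\<close> decides which one is in \<open>X\<close>.
    When only one lies in \<open>B\<close>, cancellation shows that it belongs to the meet.\<close>
  have X_coclosed: "Z x y \<or> Z y z" if v: "btw x y z" and xz: "X x z" for x y z
  proof (cases "B x y \<and> B y z")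
    case True
    then have "dcl B x y" "dcl B y z" using dcl_break[OF B _ v] XC[OF xz] by blast+
    then show ?thesis
      using xz bef_split[OF _ v] unfolding X_def Z_def by blast
  next
    case False
    moreover have "B x y \<or> B y z" using coclosedD[OF Bo v] XC[OF xz] CB by blast
    moreover have "\<not> dcl B x y" if "\<not> B y z"
      using that dcl_cancel_left[OF _ v] XC[OF xz] CB by blast
    moreover have "\<not> dcl B y z" if "\<not> B x y"
      using that dcl_cancel_right[OF B _ v] XC[OF xz] CB by blast
    ultimately show ?thesis unfolding Z_def dcl_compl_def by blast
  qed
  have "coclosed_rel Z"
    unfolding coclosed_rel_def
  proof (intro allI impI)
    fix x y z assume v: "btw x y z" and "Z x z"
    then consider "dcl_compl B x z" | "X x z" | "X z x" unfolding Z_def by blast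
    then show "Z x y \<or> Z y z"
    proof cases
      case 1
      then show ?thesis using coclosedD[OF biclosedD(3)[OF BM] v] unfolding Z_def by blast
    next
      case 3
      then show ?thesis using X_coclosed[OF btw_sym[OF v]] seg_relD(1)[OF Z_seg] by blast
    qed (use X_coclosed[OF v] in blast)
  qed
  then have Z: "biclosed Z" using Z_seg Z_closed unfolding biclosed_def closed_rel_def by blast
  have Zab: "Z a b" using ab sab unfolding Z_def X_def bef_def by blast
  have indec: "\<not> Z v b" if v: "btw a v b" "Z a v" for v
  proof
    assume vb: "Z v b"
    then have "dcl B a v" "dcl B v b" using dcl_break[OF B ab v(1)] Z_le v(2) by blast+
    then have "X a v" "X v b"
      using vb v dcl_sym bef_not_first bef_not_last unfolding Z_def dcl_compl_def X_def by blast+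
    then show False using XX by blast
  qed
  \<comment> \<open>Members of \<open>X\<close> stay inside \<open>[a, b]\<close>. Thus a member of
    \<open>Z\<close> that properly extends \<open>[a, b]\<close> comes from the meet, where
    \<open>[a, b]\<close> can be cancelled.\<close>
  have X_end: "\<not> X a c \<and> \<not> X c a" if "btw a b c" for c
    using that btw_distinct[OF that] btw_asym[of a b c] bef_not_first
    unfolding X_def bef_def by blast
  have X_start: "\<not> X c b \<and> \<not> X b c" if "btw c a b" for c
    using that btw_distinct[OF that] btw_asym[of b c a] btw_sym bef_not_last
    unfolding X_def bef_def by blast
  have "Z b c" if c: "btw a b c" "Z a c" for c
  proof -
    have "dcl_compl B a c" using X_end c unfolding Z_def by blast
    then have "B b c" "\<not> dcl B b c"
      using dcl_cancel_left[OF ab c(1)] ab c(1) unfolding dcl_compl_def by (blast intro: cl.comp)+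
    then show ?thesis unfolding Z_def dcl_compl_def by blast
  qed
  moreover have "Z c a" if c: "btw c a b" "Z c b" for c
  proof -
    have "dcl_compl B c b" using X_start c unfolding Z_def by blast
    then have "B c a" "\<not> dcl B c a"
      using dcl_cancel_right[OF B ab c(1)] ab c(1) unfolding dcl_compl_def by (blast intro: cl.comp)+
    then show ?thesis unfolding Z_def dcl_compl_def by blast
  qed
  ultimately have "descent Z a b" unfolding descent_def indec_def using Zab indec by blast
  moreover have "(Z a v \<longleftrightarrow> v \<in> L) \<and> (Z v b \<longleftrightarrow> v \<notin> L)" if v: "btw a v b" for v
  proof -
    have "Z a v" if "v \<in> L"
      using L[OF v] that v sab unfolding Z_def dcl_compl_def X_def bef_def by auto
    moreover have "Z v b" if "v \<notin> L"
      using L[OF v] that v sab unfolding Z_def dcl_compl_def X_def bef_def by auto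
    ultimately show ?thesis using indec[OF v] by blast
  qed
  moreover have "dcl_compl B \<le> Z" unfolding Z_def by blast
  ultimately show thesis using that Z Z_le by blast
qed

lemma biclosed_seg: "biclosed seg"
  unfolding biclosed_def seg_rel_def closed_rel_def coclosed_rel_def
  using btw_seg btw_seg_left seg_sym by (auto intro: sympI)

text \<open>In the full relation all cancellation conditions hold, so the descents are the
  indecomposable segments, and these generate everything.\<close>

lemma dcl_seg: "seg a b \<Longrightarrow> dcl seg a b"
proof -
  have "descent seg = indec seg"
    unfolding descent_def using btw_seg_left btw_seg_right by blast
  then show "seg a b \<Longrightarrow> dcl seg a b" using cl_indec[of seg] by simp
qed

section \<open>Intersection of two sets of labels\<close>

text \<open>The third conclusion determines which segments carry labels, and the fourth ensures that
  splits chosen inside \<open>N\<close> already lie in \<open>B\<close>. Together they give the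
  equality in \<open>labels_inter\<close>.\<close>

lemma label_intersection:
  assumes B1: "biclosed B1" and B2: "biclosed B2"
  defines "N \<equiv> \<lambda>a b. B1 a b \<and> B2 a b"
  obtains B where "biclosed B" "B \<le> N"
    "\<And>a b. dcl B a b \<longleftrightarrow> dcl B1 a b \<and> dcl B2 a b \<and> (\<forall>v. btw a v b \<longrightarrow> N a v \<or> N v b)"
    "\<And>a b v. dcl B a b \<Longrightarrow> btw a v b \<Longrightarrow> (N a v \<longrightarrow> B a v) \<and> (N v b \<longrightarrow> B v b)"
proof -
  define A where "A a b \<longleftrightarrow> dcl B1 a b \<and> dcl B2 a b \<and> (\<forall>v. btw a v b \<longrightarrow> N a v \<or> N v b)" for a b
  note S1 = biclosedD(1)[OF B1] and S2 = biclosedD(1)[OF B2]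
  have AN: "N a b" if "A a b" for a b
    using that dcl_le B1 B2 unfolding A_def N_def by blast
  have N_sym: "\<And>a b. N a b \<Longrightarrow> N b a" unfolding N_def using seg_relD(1) S1 S2 by blast
  have N_closed: "closed_rel N"
    using biclosedD(2)[OF B1] biclosedD(2)[OF B2] unfolding N_def closed_rel_def by blast
  have A_sym: "\<And>a b. A a b \<Longrightarrow> A b a"
    unfolding A_def using btw_sym N_sym seg_relD(1)[OF seg_rel_dcl] S1 S2 by blast
  have A_seg: "seg_rel A"
    using A_sym AN S1 unfolding seg_rel_def N_def by (blast intro: sympI)
  have A_left: "N v b" if "A a v" "btw a v b" "N a b" for a v b
    using that dcl_cancel_left unfolding A_def N_def by blast
  have A_right: "N a v" if "A v b" "btw a v b" "N a b" for a v b
    using that dcl_cancel_right B1 B2 unfolding A_def N_def by blast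
  have A_closed: "closed_rel A"
    unfolding closed_rel_def
  proof (intro allI impI)
    fix a v b assume v: "btw a v b" and av: "A a v" and vb: "A v b"
    have "N a w \<or> N w b" if w: "btw a w b" for w
      using v w
    proof (cases rule: btw_cases)
      case 2
      then have "N a w \<or> N w v" using av unfolding A_def by blast
      then show ?thesis using closedD[OF N_closed 2(2)] AN[OF vb] by blast
    next
      case 3
      then have "N v w \<or> N w b" using vb unfolding A_def by blast
      then show ?thesis using closedD[OF N_closed 3(1)] AN[OF av] by blast
    qed (use AN[OF av] in blast)
    then show "A a b" using av vb v unfolding A_def by (blast intro: cl.comp)
  qed
  \<comment> \<open>For a vertex \<open>w\<close> of \<open>[a, v]\<close>, one of
    \<open>[a, w]\<close> and \<open>[w, b]\<close> is in \<open>N\<close>. In the second case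
    \<open>[v, b]\<close> is cancelled from \<open>[w, b]\<close>.\<close>
  have A_break_left: "A a v" if ab: "A a b" and v: "btw a v b" "N a v" "N v b" for a v b
  proof -
    have c: "dcl B1 a v" "dcl B1 v b" "dcl B2 a v" "dcl B2 v b"
      using ab v dcl_break B1 B2 unfolding A_def N_def by blast+
    have "N a w \<or> N w v" if w: "btw a w v" for w
    proof -
      have "btw a w b" "btw w v b" using btw_initial btw_middle v(1) w by blast+
      then show ?thesis
        using ab c(2,4) dcl_cancel_right B1 B2 unfolding A_def N_def by blast
    qed
    then show ?thesis using c unfolding A_def by blast
  qed
  have A_break_right: "A v b" if "A a b" "btw a v b" "N a v" "N v b" for a v b
    using A_break_left[of b a v] A_sym N_sym btw_sym that by blast
  define E where "E = indec A"
  have EA: "A a b" if "E a b" for a b using that unfolding E_def indec_def by blast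
  have E_sym: "\<And>a b. E a b \<Longrightarrow> E b a" unfolding E_def using indec_sym A_seg by blast
  \<comment> \<open>Two pieces in \<open>N\<close> would both be in \<open>A\<close>, against
    indecomposability. So each break of a member of \<open>E\<close> has exactly one piece in
    \<open>N\<close>.\<close>
  have E_break: "\<not> N v b" if "E a b" "btw a v b" "N a v" for a v b
    using that A_break_left A_break_right unfolding E_def indec_def by blast
  have A_cl_E: "cl E a b" if "A a b" for a b
    using cl_indec[of A a b] that A_seg unfolding E_def seg_rel_def by blast
  define J where "J a b x y \<longleftrightarrow> bef a b x y \<and> (x = a \<or> N x b) \<and> (y = b \<or> N a y)" for a b x y
  define P where "P x y \<longleftrightarrow> (\<exists>a b. E a b \<and> J a b x y)" for x y
  define B where "B = cl P"
  have J_sym: "J b a y x" if "J a b x y" for a b x y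
    using that bef_sym N_sym unfolding J_def by blast
  have P_seg: "seg_rel P"
    unfolding seg_rel_def P_def using J_sym E_sym bef_seg J_def by (blast intro: sympI)
  have J_break: "J a b x y \<or> J a b y z" if "E a b" "J a b x z" "btw x y z" for a b x y z
    using that bef_split[of a b x z y] EA unfolding J_def A_def by blast
  then have P_coclosed: "coclosed_rel P" unfolding coclosed_rel_def P_def by blast
  \<comment> \<open>The essential case has \<open>x\<close> and \<open>y\<close> both strictly
    inside. If \<open>[x, y]\<close> were missing, coclosure would give \<open>[y, b]\<close>,
    \<open>dcl_break\<close> would make it a composite of descents, and cancelling it from
    \<open>[x, b]\<close> would return \<open>[x, y]\<close>.\<close>
  have J_N: "N x y" if e: "E a b" and j: "J a b x y" for a b x y
  proof -
    have aux: "B' x y" if B': "biclosed B'" "dcl B' a b" "x = a \<or> B' x b" "y = b \<or> B' a y" for B'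
    proof -
      note [simp] = dcl_le[OF B'(1,2)]
      consider "x = a" "y = b" | "x = a" "btw a y b" | "btw a x b" "y = b" | "btw a x b" "btw x y b"
        using j unfolding J_def bef_def by blast
      then show ?thesis
      proof cases
        case 4
        then have y: "btw a y b" "B' a y" "B' x b"
          using btw_final btw_distinct B'(3,4) by blast+
        show ?thesis
        proof (rule ccontr)
          assume n: "\<not> B' x y"
          then have "B' y b" using coclosedD[OF biclosedD(3)[OF B'(1)] 4(2) y(3)] by blast
          then have "dcl B' y b" using dcl_break[OF B'(1,2) y(1,2)] by blast
          then show False using dcl_cancel_right[OF B'(1) _ 4(2) y(3)] n by blast
        qed
      qed (use B' btw_distinct in auto)
    qed
    show ?thesis using aux[OF B1] aux[OF B2] j EA[OF e] unfolding J_def A_def N_def by blast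
  qed
  have BN: "N x y" if "B x y" for x y
    using cl_least[of P x y N] that N_closed J_N unfolding B_def P_def by blast
  have B: "biclosed B"
    unfolding biclosed_def B_def using cl_closed cl_coclosed[OF P_coclosed] seg_rel_cl[OF P_seg] by blast
  have B_sym: "\<And>x y. B x y \<Longrightarrow> B y x" using seg_relD(1)[OF biclosedD(1)[OF B]] .
  have EP: "P a b" if "E a b" for a b
    using that seg_relD(2)[OF A_seg EA] unfolding P_def J_def bef_def by blast
  have AB: "B a b" if "A a b" for a b
    using cl_least[OF A_cl_E[OF that], of B] EP cl_closed unfolding B_def by (blast intro: cl.base)
  have split_left: "B a v" if "A a b" "btw a v b" "N a v" for a v b
    using A_cl_E[OF that(1)] that(2,3)
  proof (induction arbitrary: v rule: cl.induct)
    case (base a b)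
    then have "J a b a v" using btw_seg unfolding J_def bef_def by blast
    then show ?case using base unfolding B_def P_def by (blast intro: cl.base)
  next
    case (comp a w b)
    have A: "A a w" "A w b"
      using comp.hyps cl_least[of E _ _ A] A_closed EA by blast+
    show ?case using comp.hyps(1) comp.prems(1)
    proof (cases rule: btw_cases)
      case 1
      then show ?thesis using AB A by blast
    next
      case 2
      then show ?thesis using comp by blast
    next
      case 3
      then have "N w v" using A_left A comp.prems by blast
      then have "B w v" using comp.IH 3 by blast
      then show ?thesis using closedD[OF biclosedD(2)[OF B] 3(1)] AB A by blast
    qed
  qed
  have split_right: "B v b" if "A a b" "btw a v b" "N v b" for a v b
    using split_left[of b a v] that A_sym N_sym btw_sym B_sym by blast
  \<comment> \<open>A failure of cancellation can be moved to a generator. If the composite is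
    formed at \<open>z\<close> beyond \<open>v\<close>, the failure persists for
    \<open>[u, z]\<close>; if \<open>z\<close> is before \<open>v\<close>, indecomposability and
    coclosure put \<open>[v, w]\<close> into \<open>B\<close>.\<close>
  have exchange: "\<exists>y. P u y \<and> btw u v y \<and> \<not> B v y"
    if "indec B u v" "btw u v w" "B u w" "\<not> B v w" for u v w
    using that(3)[unfolded B_def] that(1,2,4)
  proof (induction rule: cl.induct)
    case (comp u z w)
    show ?case using comp.hyps(1) comp.prems(2)
    proof (cases rule: btw_cases)
      case 1
      then show ?thesis using comp unfolding B_def by blast
    next
      case 2
      then have "\<not> B v z" using comp.prems(3) comp.hyps(3) closedD[OF biclosedD(2)[OF B] 2(2)]
        unfolding B_def by blast
      then show ?thesis using comp 2 by blast
    next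
      case 3
      then have "\<not> B z v" using comp.prems(1) comp.hyps(2) unfolding indec_def B_def by blast
      then show ?thesis using coclosedD[OF biclosedD(3)[OF B] 3(2)] comp.prems(3) comp.hyps(3)
        unfolding B_def by blast
    qed
  qed blast
  have E_indec: "indec B a b" if "E a b" for a b
    unfolding indec_def using that E_break BN AB EA by blast
  \<comment> \<open>For the generator \<open>[u, y]\<close> inside some \<open>[a, b]\<close> of
    \<open>E\<close>, the break at \<open>v\<close> has \<open>[a, v]\<close> in \<open>N\<close>,
    so \<open>[v, b]\<close> is not. But \<open>[u, b]\<close> is in \<open>N\<close>, and
    cancelling \<open>[u, v]\<close> from it gives \<open>[v, b]\<close>.\<close>
  have E_right: "B v w" if e: "E u v" and w: "btw u v w" "B u w" for u v w
  proof (rule ccontr)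
    assume "\<not> B v w"
    then obtain y where y: "P u y" "btw u v y" "\<not> B v y" using exchange[OF E_indec[OF e] w] by blast
    then obtain a b where ab: "E a b" "J a b u y" unfolding P_def by blast
    then have "J a b u v" using J_break[OF ab y(2)] y(3) unfolding B_def P_def by (blast intro: cl.base)
    have v: "btw a v b" using bef_split(3) ab(2) y(2) unfolding J_def by blast
    then have "N a v" using \<open>J a b u v\<close> btw_distinct unfolding J_def by blast
    then have nvb: "\<not> N v b" using E_break ab(1) v by blast
    have "bef a b u v" "N u b" using \<open>J a b u v\<close> AN[OF EA[OF ab(1)]] unfolding J_def by blast+
    then have "btw u v b" using v btw_distinct(2)[OF v] unfolding bef_def by blast
    then show False using A_left[OF EA[OF e]] \<open>N u b\<close> nvb by blast
  qed
  have E_descent: "descent B a b" if "E a b" for a b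
    unfolding descent_def using that E_indec E_right E_right[OF E_sym[OF that]] btw_sym B_sym by blast
  \<comment> \<open>If \<open>y\<close> were not \<open>b\<close>, then \<open>[a, y]\<close> would
    be in \<open>N\<close> and \<open>[y, b]\<close> not. Since \<open>[x, b]\<close> is also a
    generator, cancelling the descent \<open>[x, y]\<close> from it would give
    \<open>[y, b]\<close>.\<close>
  have descent_end: "y = b" if d: "descent B x y" and e: "E a b" and j: "J a b x y" for a b x y
  proof (rule ccontr)
    assume y: "y \<noteq> b"
    then have bt: "btw a y b" using j btw_final unfolding J_def bef_def by blast
    then have "\<not> N y b" using y j e E_break unfolding J_def by blast
    then have "\<not> B y b" using BN by blast
    moreover have "btw x y b" using j y bt unfolding J_def bef_def by blast
    moreover have "J a b x b" using j unfolding J_def bef_def by blast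
    then have "B x b" using e unfolding B_def P_def by (blast intro: cl.base)
    ultimately show False using d unfolding descent_def by blast
  qed
  have descent_E: "E x y" if d: "descent B x y" for x y
  proof -
    have "P x y" using d unfolding descent_def indec_def B_def by (blast elim: cl.cases)
    then obtain a b where ab: "E a b" "J a b x y" unfolding P_def by blast
    then have "y = b" using descent_end d by blast
    moreover have "x = a"
      using descent_end[OF descent_sym[OF biclosedD(1)[OF B] d] E_sym[OF ab(1)] J_sym[OF ab(2)]] .
    ultimately show ?thesis using ab by blast
  qed
  have "descent B = E" using E_descent descent_E by blast
  then have "dcl B a b \<longleftrightarrow> A a b" for a b
    using A_cl_E cl_least[of E a b A] A_closed EA by (auto simp: le_fun_def)
  then show thesis using that B BN split_left split_right unfolding A_def by blast
qed

end
subsection \<open>Segments of an embedded tree\<close>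

context embedded_tree
begin

section \<open>Uniqueness of paths and betweenness in the tree\<close>

lemma walk_appendD:
  assumes "walk T (xs @ ys)"
  shows "xs \<noteq> [] \<Longrightarrow> walk T xs" "ys \<noteq> [] \<Longrightarrow> walk T ys"
  using assms by (auto simp: walk_def successively_append_iff)

lemma walk_join: "walk T (xs @ [v]) \<Longrightarrow> walk T (v # ys) \<Longrightarrow> walk T (xs @ v # ys)"
  by (auto simp: walk_def successively_append_iff successively_Cons)

lemma walk_rev: "walk T (rev xs) \<longleftrightarrow> walk T xs"
  by (simp add: walk_def insert_commute)

lemma walk_unique:
  assumes "walk T (a # xs)" "walk T (a # ys)" "distinct (a # xs)" "distinct (a # ys)"
    "last (a # xs) = last (a # ys)"
  shows "xs = ys"
  using assms
proof (induction xs arbitrary: a ys)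
  case Nil
  then show ?case by (cases ys) (auto split: if_splits)
next
  case (Cons x xs)
  obtain y ys' where ys: "ys = y # ys'" using Cons.prems by (cases ys) (auto split: if_splits)
  have "x = y"
  proof (rule ccontr)
    assume "x \<noteq> y"
    have "last (x # xs) \<in> set ys" using Cons.prems(5) ys by auto
    then have "\<exists>w\<in>set (x # xs). w \<in> set ys" using last_in_set by blast
    \<comment> \<open>\<open>w\<close> is the first vertex at which the first walk meets the second
      one again. The two stretches from \<open>a\<close> to \<open>w\<close> form a cycle, closed by
      the edge between \<open>y\<close> and \<open>a\<close>.\<close>
    then obtain u w u' where u: "x # xs = u @ w # u'" "w \<in> set ys" "\<forall>z\<in>set u. z \<notin> set ys"
      by (rule split_list_first_propE)
    obtain v v' where v: "ys = v @ w # v'" using u(2) by (auto dest: split_list)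
    have "walk T ((a # u @ [w]) @ u')" using Cons.prems(1) u(1) by simp
    then have w1: "walk T (a # u @ [w])" using walk_appendD by blast
    have "walk T ((a # v @ [w]) @ v')" using Cons.prems(2) v by simp
    then have "walk T (v @ [w])"
      using walk_appendD(1)[of "a # v @ [w]"] walk_appendD(2)[of "[a]" "v @ [w]"] by simp
    then have "walk T (w # rev v)" using walk_rev[of "v @ [w]"] by simp
    then have "walk T (a # u @ w # rev v)" using walk_join[of "a # u"] w1 by simp
    moreover have "distinct (a # u @ w # rev v)"
      using Cons.prems(3,4) u v by auto
    moreover have "3 \<le> length (a # u @ w # rev v)"
      using \<open>x \<noteq> y\<close> u(1) v ys by (cases u; cases v) auto
    moreover have "last (a # u @ w # rev v) = y" using v ys by (cases v) auto
    moreover have "{y, a} \<in> edges T"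
      using Cons.prems(2) ys by (auto simp: walk_def insert_commute)
    ultimately show False using acyclic[of "a # u @ w # rev v"] by simp
  qed
  moreover have "walk T (x # xs)" using walk_appendD(2)[of "[a]" "x # xs"] Cons.prems(1) by simp
  moreover have "walk T ys" using walk_appendD(2)[of "[a]" ys] Cons.prems(2) ys by simp
  ultimately show ?case using Cons.IH[of x ys'] Cons.prems ys by auto
qed

lemma seg_path_sub:
  assumes "seg_path T (p @ xs @ q)" "2 \<le> length xs" shows "seg_path T xs"
  unfolding seg_path_def
proof (intro conjI allI impI)
  show "walk T xs"
    using assms walk_appendD[of p "xs @ q"] walk_appendD[of xs q] by (force simp: seg_path_def)
  fix j assume j: "j + 2 < length xs"
  have nth: "(p @ xs @ q) ! (length p + i) = xs ! i" if "i < length xs" for i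
    using that by (simp add: nth_append)
  have "length p + j + 2 < length (p @ xs @ q)" using j by simp
  then have "(p @ xs @ q) ! (length p + j + 2) =
      cw T ((p @ xs @ q) ! (length p + j + 1)) ((p @ xs @ q) ! (length p + j)) \<or>
    (p @ xs @ q) ! (length p + j) =
      cw T ((p @ xs @ q) ! (length p + j + 1)) ((p @ xs @ q) ! (length p + j + 2))"
    using assms(1) unfolding seg_path_def by blast
  then show
    "xs ! (j + 2) = cw T (xs ! (j + 1)) (xs ! j) \<or> xs ! j = cw T (xs ! (j + 1)) (xs ! (j + 2))"
    using nth[of j] nth[of "j + 1"] nth[of "j + 2"] j by (simp only: add.assoc)
qed (use assms in \<open>auto simp: seg_path_def\<close>)

lemma seg_path_rev:
  assumes "seg_path T xs" shows "seg_path T (rev xs)"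
  unfolding seg_path_def
proof (intro conjI allI impI)
  fix j assume j: "j + 2 < length (rev xs)"
  \<comment> \<open>Position \<open>k\<close> of \<open>xs\<close> is position \<open>j + 2\<close>
    of the reversed list. Reversal exchanges the two alternatives of the turning condition.\<close>
  define k where "k = length xs - (j + 3)"
  have "rev xs ! j = xs ! (k + 2)" "rev xs ! (j + 1) = xs ! (k + 1)" "rev xs ! (j + 2) = xs ! k"
    using j by (simp_all add: rev_nth k_def Suc_diff_Suc numeral_3_eq_3)
  moreover have "k + 2 < length xs" using j by (simp add: k_def)
  ultimately show "rev xs ! (j + 2) = cw T (rev xs ! (j + 1)) (rev xs ! j) \<or>
      rev xs ! j = cw T (rev xs ! (j + 1)) (rev xs ! (j + 2))"
    using assms unfolding seg_path_def by metis
qed (use assms in \<open>auto simp: seg_path_def walk_rev\<close>)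

definition path :: "'a \<Rightarrow> 'a \<Rightarrow> 'a list \<Rightarrow> bool" where
  "path a b xs \<longleftrightarrow> seg_path T xs \<and> hd xs = a \<and> last xs = b"

definition seg :: "'a \<Rightarrow> 'a \<Rightarrow> bool" where
  "seg a b \<longleftrightarrow> (\<exists>xs. path a b xs)"

definition btw :: "'a \<Rightarrow> 'a \<Rightarrow> 'a \<Rightarrow> bool" where
  "btw a v b \<longleftrightarrow> (\<exists>p q. path a b (p @ v # q) \<and> p \<noteq> [] \<and> q \<noteq> [])"

text \<open>By \<open>path_unique\<close> the path is determined when \<open>seg a b\<close> holds.
  Otherwise the value is unspecified, which is why \<open>rel\<close> also demands
  \<open>seg a b\<close>.\<close>

definition vset :: "'a \<Rightarrow> 'a \<Rightarrow> 'a set" where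
  "vset a b = set (THE xs. path a b xs)"

lemma path_unique:
  assumes "path a b xs" "path a b ys" shows "xs = ys"
proof -
  have props: "zs = a # tl zs" "walk T zs" "distinct zs" "last zs = b" if "path a b zs" for zs
    using that by (auto simp: path_def seg_path_def walk_def)
  show ?thesis
    using walk_unique[of a "tl xs" "tl ys"] props[OF assms(1)] props[OF assms(2)] by metis
qed

lemma path_rev: "path a b xs \<Longrightarrow> path b a (rev xs)"
  by (auto simp: path_def seg_path_rev hd_rev last_rev)

lemma path_sub: "path a b (p @ xs @ q) \<Longrightarrow> 2 \<le> length xs \<Longrightarrow> path (hd xs) (last xs) xs"
  using seg_path_sub by (auto simp: path_def)

lemma path_prefix: "path a b (p @ v # q) \<Longrightarrow> p \<noteq> [] \<Longrightarrow> path a v (p @ [v])"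
  using path_sub[of a b "[]" "p @ [v]" q] by (cases p) (auto simp: path_def)

lemma path_suffix: "path a b (p @ v # q) \<Longrightarrow> q \<noteq> [] \<Longrightarrow> path v b (v # q)"
  using path_sub[of a b p "v # q" "[]"] by (cases q) (auto simp: path_def)

lemma vset_path: "path a b xs \<Longrightarrow> vset a b = set xs"
  unfolding vset_def using path_unique by (metis the_equality)

lemma seg_obtain:
  assumes "seg a b" obtains xs where "path a b xs" "vset a b = set xs"
  using assms vset_path unfolding seg_def by blast

lemma vset_sym: "seg a b \<Longrightarrow> vset a b = vset b a"
  by (metis seg_obtain path_rev vset_path set_rev)

lemma btw_obtain:
  assumes "btw a v b"
  obtains p q where "path a b (p @ v # q)" "p \<noteq> []" "q \<noteq> []" "path a v (p @ [v])" "path v b (v # q)"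
  using assms path_prefix path_suffix unfolding btw_def by blast

lemma path_distinct: "path a b xs \<Longrightarrow> distinct xs"
  by (simp add: path_def seg_path_def)

lemma path_ends: "path a b xs \<Longrightarrow> a \<noteq> b \<and> a \<in> set xs \<and> b \<in> set xs"
  by (cases xs) (auto simp: path_def seg_path_def dest: last_in_set split: if_splits)

lemma btw_path: "path a b (p @ v # q) \<Longrightarrow> p \<noteq> [] \<Longrightarrow> q \<noteq> [] \<Longrightarrow> btw a v b"
  unfolding btw_def by blast

text \<open>Uniqueness of paths turns betweenness into a statement about positions in one
  list.\<close>

sublocale betweenness seg btw
proof
  fix a b v w
  show "\<not> seg a a" using path_ends unfolding seg_def by blast
  show "seg b a" if "seg a b" using that path_rev unfolding seg_def by blast
  show "btw b v a" if v: "btw a v b"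
  proof -
    obtain p q where "path a b (p @ v # q)" "p \<noteq> []" "q \<noteq> []" using v btw_obtain by metis
    then show ?thesis using path_rev[of a b "p @ v # q"] btw_path[of b a "rev q" v "rev p"] by simp
  qed
  show "seg a b" if "btw a v b" using that unfolding btw_def seg_def by blast
  show "seg a v" if "btw a v b" using that btw_obtain unfolding seg_def by metis
  {
    assume vw: "btw a v b" "btw a w v"
    obtain p q where v: "path a b (p @ v # q)" "p \<noteq> []" "q \<noteq> []" "path a v (p @ [v])"
      using vw(1) btw_obtain by metis
    obtain p' q' where w: "path a v (p' @ w # q')" "p' \<noteq> []" "q' \<noteq> []"
      using vw(2) btw_obtain by metis
    have eq: "p @ [v] = p' @ w # q'" using path_unique v(4) w(1) .
    obtain r where "q' = r @ [v]"
      by (metis eq w(3) append_butlast_last_id last.simps last_append list.distinct(1) last_snoc)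
    then have p: "p = p' @ w # r" using eq by simp
    show "btw a w b" using btw_path[of a b p' w "r @ v # q"] v(1) w(2) p by simp
    have "path w b (w # r @ v # q)" using path_suffix[of a b p' w "r @ v # q"] v(1) p by simp
    then show "btw w v b" using btw_path[of w b "w # r" v q] v(3) by simp
  }
  show "v = w \<or> btw a v w \<or> btw a w v" if vw: "btw a v b" "btw a w b"
  proof -
    obtain p q where v: "path a b (p @ v # q)" "p \<noteq> []" "path a v (p @ [v])"
      using vw(1) btw_obtain by metis
    obtain p' q' where w: "path a b (p' @ w # q')" "p' \<noteq> []" "path a w (p' @ [w])"
      using vw(2) btw_obtain by metis
    have "p @ v # q = p' @ w # q'" using path_unique v(1) w(1) .
    then obtain us where "p = p' @ us \<and> us @ v # q = w # q' \<or> p @ us = p' \<and> v # q = us @ w # q'"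
      by (auto simp: append_eq_append_conv2)
    then show ?thesis
    proof (elim disjE conjE)
      assume "p = p' @ us" "us @ v # q = w # q'"
      then show ?thesis using v(3) w(2) btw_path[of a v p' w "tl us @ [v]"] by (cases us) auto
    next
      assume "p @ us = p'" "v # q = us @ w # q'"
      then show ?thesis using w(3) v(2) btw_path[of a w p v "tl us @ [w]"] by (cases us) auto
    qed
  qed
  have "{v. \<exists>a b. btw a v b} \<subseteq> verts T"
    unfolding btw_def path_def seg_path_def walk_def by auto
  then show "finite {v. \<exists>a b. btw a v b}" using finite_verts finite_subset by blast
qed

section \<open>Segments as vertex sets\<close>

text \<open>The stretch of \<open>xs\<close> between \<open>c\<close> and \<open>d\<close> is itself
  a path, so by uniqueness it is \<open>ys\<close>, up to the direction in which \<open>xs\<close>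
  meets the two vertices.\<close>

lemma subpath:
  assumes xs: "path a b xs" and ys: "path c d ys" and sub: "c \<in> set xs" "d \<in> set xs"
  obtains p zs q where "xs = p @ zs @ q" "zs = ys \<or> zs = rev ys"
proof -
  have "c \<noteq> d" using path_ends[OF ys] by blast
  obtain p q where c: "xs = p @ c # q" using sub by (auto dest: split_list)
  then consider "d \<in> set p" | "d \<in> set q" using sub \<open>c \<noteq> d\<close> by auto
  then show thesis
  proof cases
    case 1
    then obtain p' r where d: "p = p' @ d # r" by (auto dest: split_list)
    have "path d c (d # r @ [c])" using path_sub[of a b p' "d # r @ [c]" q] xs c d by simp
    then have "rev ys = d # r @ [c]" using path_rev[OF ys] path_unique by blast
    then show thesis using that[of p' "rev ys" q] c d by simp
  next
    case 2
    then obtain q' r where d: "q = r @ d # q'" by (auto dest: split_list)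
    have "path c d (c # r @ [d])" using path_sub[of a b p "c # r @ [d]" q'] xs c d by simp
    then have "ys = c # r @ [d]" using ys path_unique by blast
    then show thesis using that[of p ys q'] c d by simp
  qed
qed

text \<open>One path is a stretch of the other, up to reversal, and has the same length. This
  justifies identifying segments with vertex sets.\<close>

lemma vset_inj:
  assumes "seg a b" "seg c d" "vset c d = vset a b"
  shows "c = a \<and> d = b \<or> c = b \<and> d = a"
proof -
  obtain xs ys where xs: "path a b xs" and ys: "path c d ys" and eq: "set ys = set xs"
    using assms seg_obtain by metis
  obtain p zs q where pq: "xs = p @ zs @ q" "zs = ys \<or> zs = rev ys"
    using subpath[OF xs ys] path_ends[OF ys] eq by auto
  have "length xs = length ys"
    using eq path_distinct[OF xs] path_distinct[OF ys] by (metis distinct_card)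
  then have "xs = ys \<or> xs = rev ys" using pq by auto
  then show ?thesis
    using xs ys path_rev[OF ys] by (auto simp: path_def hd_rev last_rev)
qed

lemma Seg_iff: "s \<in> Seg T \<longleftrightarrow> (\<exists>a b. seg a b \<and> s = vset a b)"
proof
  assume "s \<in> Seg T"
  then obtain xs where "s = set xs" "seg_path T xs" unfolding Seg_def by blast
  then have "path (hd xs) (last xs) xs" by (simp add: path_def)
  then show "\<exists>a b. seg a b \<and> s = vset a b"
    using vset_path \<open>s = set xs\<close> unfolding seg_def by metis
next
  assume "\<exists>a b. seg a b \<and> s = vset a b"
  then show "s \<in> Seg T" unfolding Seg_def path_def by (auto elim!: seg_obtain simp: path_def)
qed

lemma endpoints_vset:
  assumes "seg a b" shows "endpoints T (vset a b) = {a, b}"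
proof -
  obtain xs where xs: "path a b xs" "vset a b = set xs" using assms seg_obtain by blast
  have "{hd ys, last ys} = {a, b}" if "seg_path T ys" "set ys = vset a b" for ys
  proof -
    have "path (hd ys) (last ys) ys" using that by (simp add: path_def)
    then show ?thesis
      using vset_inj[of a b "hd ys" "last ys"] vset_path that assms unfolding seg_def by auto
  qed
  then show ?thesis using xs unfolding endpoints_def path_def by blast
qed

lemma vset_btw_psubset:
  assumes "btw a v b"
  shows "vset a v \<subset> vset a b" "vset v b \<subset> vset a b" "vset a v \<union> vset v b = vset a b"
proof -
  obtain p q where pq: "path a b (p @ v # q)" "p \<noteq> []" "q \<noteq> []" "path a v (p @ [v])" "path v b (v # q)"
    using assms btw_obtain by metis
  then have "vset a v = insert v (set p)" "vset v b = insert v (set q)"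
    "vset a b = insert v (set p \<union> set q)" using vset_path by auto
  moreover have "hd p \<in> set p" "hd p \<noteq> v" "hd p \<notin> set q" "last q \<in> set q" "last q \<noteq> v" "last q \<notin> set p"
    using path_distinct[OF pq(1)] hd_in_set[OF pq(2)] last_in_set[OF pq(3)]
    by (auto simp del: hd_in_set last_in_set)
  ultimately show "vset a v \<subset> vset a b" "vset v b \<subset> vset a b" "vset a v \<union> vset v b = vset a b"
    by blast+
qed

lemma splits_vset:
  assumes ab: "seg a b"
  shows "splits T (vset a b) = {vset a v | v. btw a v b} \<union> {vset v b | v. btw a v b}"
proof
  show "{vset a v | v. btw a v b} \<union> {vset v b | v. btw a v b} \<subseteq> splits T (vset a b)"
  proof -
    have "vset a v \<in> splits T (vset a b) \<and> vset v b \<in> splits T (vset a b)" if v: "btw a v b" for v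
      using vset_btw_psubset[OF v] endpoints_vset[OF ab] endpoints_vset[OF btw_seg_left[OF v]]
        endpoints_vset[OF btw_seg_right[OF v]] Seg_iff btw_seg_left[OF v] btw_seg_right[OF v]
      unfolding splits_def by blast
    then show ?thesis by blast
  qed
next
  show "splits T (vset a b) \<subseteq> {vset a v | v. btw a v b} \<union> {vset v b | v. btw a v b}"
  proof
    fix t assume t: "t \<in> splits T (vset a b)"
    then obtain c d where cd: "seg c d" "t = vset c d" unfolding splits_def Seg_iff by blast
    obtain xs where xs: "path a b xs" "vset a b = set xs" using ab seg_obtain by blast
    obtain ys where ys: "path c d ys" "t = set ys" using cd seg_obtain by metis
    have sub: "set ys \<subset> set xs" using t xs ys unfolding splits_def by blast
    have ends: "{c, d} \<inter> {a, b} \<noteq> {}"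
      using t endpoints_vset[OF ab] endpoints_vset[OF cd(1)] cd(2) unfolding splits_def by simp
    obtain p zs q where zs: "xs = p @ zs @ q" "zs = ys \<or> zs = rev ys"
      using subpath[OF xs(1) ys(1)] path_ends[OF ys(1)] sub by blast
    \<comment> \<open>The endpoints are renamed so that \<open>zs\<close> runs in the direction of
      \<open>xs\<close>.\<close>
    define c' d' where "c' = hd zs" "d' = last zs"
    have "{c', d'} = {c, d}"
      using zs(2) ys(1) by (auto simp: path_def c'_d'_def hd_rev last_rev)
    moreover have "path c' d' zs" using zs(2) ys(1) path_rev[OF ys(1)]
      by (auto simp: path_def c'_d'_def)
    ultimately have zs: "path c' d' zs" "t = set zs" "xs = p @ zs @ q" "{c', d'} = {c, d}"
      using zs ys(2) by auto
    have ne: "zs \<noteq> []" using zs(1) by (auto simp: path_def seg_path_def)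
    have c'd': "hd zs = c'" "last zs = d'" "c' \<noteq> d'"
      using path_ends[OF zs(1)] by (auto simp: c'_d'_def)
    have hl: "hd xs = a" "last xs = b" using xs(1) by (auto simp: path_def)
    have dist: "distinct (p @ zs @ q)" using path_distinct[OF xs(1)] zs(3) by simp
    \<comment> \<open>If both parts were nonempty, they would contain \<open>a\<close> and
      \<open>b\<close>, leaving \<open>zs\<close> without a common endpoint. So a split is a prefix
      or a suffix.\<close>
    have "p = [] \<or> q = []"
    proof (rule ccontr)
      assume "\<not> (p = [] \<or> q = [])"
      then have "a \<in> set p" "b \<in> set q" using hl zs(3) by auto
      then have "a \<notin> set zs" "b \<notin> set zs" using dist by auto
      then have "{c', d'} \<inter> {a, b} = {}" using path_ends[OF zs(1)] by blast
      then show False using ends zs(4) by simp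
    qed
    moreover have "p \<noteq> [] \<or> q \<noteq> []" using sub ys(2) zs(2,3) by auto
    ultimately consider "p = []" "q \<noteq> []" | "q = []" "p \<noteq> []" by blast
    then show "t \<in> {vset a v | v. btw a v b} \<union> {vset v b | v. btw a v b}"
    proof cases
      case 1
      have "c' = a" using 1 zs(3) hl(1) c'd'(1) ne by auto
      moreover obtain r where r: "zs = r @ [d']" using ne c'd'(2) append_butlast_last_id by metis
      moreover have "r \<noteq> []" using r c'd' by auto
      then have "btw a d' b" using xs(1) zs(3) r 1 btw_path[of a b r d' q] by simp
      ultimately show ?thesis using vset_path[OF zs(1)] zs(2) by blast
    next
      case 2
      have "d' = b" using 2 zs(3) hl(2) c'd'(2) ne by auto
      moreover obtain r where r: "zs = c' # r" using ne c'd'(1) by (cases zs) auto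
      moreover have "r \<noteq> []" using r c'd' by auto
      then have "btw a c' b" using xs(1) zs(3) r 2 btw_path[of a b p c' r] by simp
      ultimately show ?thesis using vset_path[OF zs(1)] zs(2) by blast
    qed
  qed
qed

section \<open>Translation between sets of segments and relations\<close>

definition rel :: "'a set set \<Rightarrow> 'a \<Rightarrow> 'a \<Rightarrow> bool" where
  "rel B a b \<longleftrightarrow> seg a b \<and> vset a b \<in> B"

definition ext :: "('a \<Rightarrow> 'a \<Rightarrow> bool) \<Rightarrow> 'a set set" where
  "ext R = {vset a b | a b. R a b}"

lemma seg_rel_rel: "seg_rel (rel B)"
  unfolding seg_rel_def rel_def using seg_sym vset_sym by (auto intro!: sympI)

lemma rel_ext:
  assumes R: "seg_rel R" shows "rel (ext R) = R"
proof -
  have "R a b" if ab: "seg a b" and cd: "R c d" and eq: "vset a b = vset c d" for a b c d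
    using vset_inj[OF ab seg_relD(2)[OF R cd] eq[symmetric]] cd seg_relD(1)[OF R cd] by auto
  then show ?thesis
    unfolding rel_def ext_def fun_eq_iff using seg_relD(2)[OF R] by blast
qed

lemma ext_subset_Seg: "seg_rel R \<Longrightarrow> ext R \<subseteq> Seg T"
  unfolding ext_def using Seg_iff seg_relD(2) by blast

lemma subset_iff_rel:
  assumes "B \<subseteq> Seg T" shows "B \<subseteq> B' \<longleftrightarrow> rel B \<le> rel B'"
proof
  assume le: "rel B \<le> rel B'"
  show "B \<subseteq> B'"
  proof
    fix s assume s: "s \<in> B"
    then obtain a b where ab: "seg a b" "s = vset a b" using assms Seg_iff[of s] by blast
    then have "rel B a b" using s by (simp add: rel_def)
    then have "rel B' a b" using le by blast
    then show "s \<in> B'" using ab by (simp add: rel_def)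
  qed
qed (auto simp: rel_def)

lemma closed_segs_iff: "closed_segs T B \<longleftrightarrow> closed_rel (rel B)"
proof -
  have "btw a v b \<and> vset a v = s1 \<and> vset v b = s2 \<and> vset a b = s1 \<union> s2"
    if "seg_path T (p @ [v])" "seg_path T (v # q)" "seg_path T (p @ v # q)"
      "s1 = set (p @ [v])" "s2 = set (v # q)" "a = hd p" "b = last q" for p v q s1 s2 a b
  proof -
    have ne: "p \<noteq> []" "q \<noteq> []" using that by (auto simp: seg_path_def)
    then have "path a b (p @ v # q)" "path a v (p @ [v])" "path v b (v # q)"
      using that by (auto simp: path_def)
    then show ?thesis using ne that btw_path vset_path by auto
  qed
  note comp = this
  have 1: "\<exists>a v b. btw a v b \<and> vset a v = s1 \<and> vset v b = s2 \<and> vset a b = s1 \<union> s2"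
    if c: "composable T s1 s2" for s1 s2
  proof -
    obtain p v q where "seg_path T (p @ [v])" "seg_path T (v # q)" "seg_path T (p @ v # q)"
      "s1 = set (p @ [v])" "s2 = set (v # q)" using c unfolding composable_def by blast
    from comp[OF this refl refl] show ?thesis by blast
  qed
  have 2: "composable T (vset a v) (vset v b)" if "btw a v b" for a v b
  proof -
    obtain p q where "path a b (p @ v # q)" "path a v (p @ [v])" "path v b (v # q)"
      using \<open>btw a v b\<close> btw_obtain by metis
    then show ?thesis unfolding composable_def using vset_path unfolding path_def by metis
  qed
  show ?thesis
  proof
    assume c: "closed_segs T B"
    show "closed_rel (rel B)"
      unfolding closed_rel_def rel_def
      using c 2 vset_btw_psubset(3) btw_seg unfolding closed_segs_def by metis
  next
    assume "closed_rel (rel B)"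
    then show "closed_segs T B"
      using 1 btw_seg btw_seg_left btw_seg_right unfolding closed_segs_def closed_rel_def rel_def by metis
  qed
qed

lemma coclosed_segs_iff: "closed_segs T (Seg T - B) \<longleftrightarrow> coclosed_rel (rel B)"
proof -
  have "vset a b \<in> Seg T" if "seg a b" for a b using that Seg_iff by blast
  then have "rel (Seg T - B) a b \<longleftrightarrow> seg a b \<and> \<not> rel B a b" for a b by (auto simp: rel_def)
  then show ?thesis
    unfolding closed_segs_iff closed_rel_def coclosed_rel_def
    using btw_seg btw_seg_left btw_seg_right by metis
qed

lemma Bic_iff: "B \<in> Bic T \<longleftrightarrow> B \<subseteq> Seg T \<and> biclosed (rel B)"
  unfolding Bic_def biclosed_def using closed_segs_iff coclosed_segs_iff seg_rel_rel by blast

lemma ext_Bic: "biclosed R \<Longrightarrow> ext R \<in> Bic T"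
  using Bic_iff ext_subset_Seg rel_ext biclosedD(1) by metis

lemma rel_remove:
  assumes "seg a b" shows "rel (B - {vset a b}) = remove (rel B) a b"
proof -
  have "vset x y = vset a b \<longleftrightarrow> x = a \<and> y = b \<or> x = b \<and> y = a" if "seg x y" for x y
    using vset_inj[OF assms that] vset_sym[OF assms] by auto
  then show ?thesis unfolding rel_def remove_def fun_eq_iff by auto
qed

section \<open>Covers, their meet and their labels\<close>

lemma descent_cover:
  assumes B: "B \<in> Bic T" and d: "descent (rel B) a b"
  shows "bic_covers T (B - {vset a b}) B" "vset a b \<in> B" "seg a b"
proof -
  have r: "rel B a b" using d descents_le by blast
  then show ab: "seg a b" "vset a b \<in> B" unfolding rel_def by auto
  have "B - {vset a b} \<in> Bic T"
    using B d descent_iff_biclosed_remove[of "rel B" a b] r rel_remove[OF ab(1)]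
    unfolding Bic_iff by auto
  then show "bic_covers T (B - {vset a b}) B" unfolding bic_covers_def using B ab by blast
qed

text \<open>Removing a descent of \<open>Z\<close> outside \<open>W\<close> leaves a biclosed set
  that contains \<open>W\<close>, and the covering relation forces equality. Hence
  \<open>the_elem\<close> in \<open>cover_label\<close> is applied to a singleton.\<close>

lemma cover_descent:
  assumes "bic_covers T W Z"
  obtains a b where "descent (rel Z) a b" "W = Z - {vset a b}"
proof -
  have W: "W \<in> Bic T" and Z: "Z \<in> Bic T" and sub: "W \<subset> Z"
    using assms unfolding bic_covers_def by auto
  obtain a b where "rel Z a b" "\<not> rel W a b"
    using sub subset_iff_rel[of Z W] Z unfolding Bic_iff by blast
  moreover have "rel W \<le> rel Z" using sub subset_iff_rel[of W Z] W unfolding Bic_iff by blast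
  ultimately obtain a b where ab: "descent (rel Z) a b" "\<not> rel W a b"
    using exists_descent[of "rel Z" "rel W"] W Z Bic_iff by metis
  note c = descent_cover[OF Z ab(1)]
  then have "W \<subseteq> Z - {vset a b}" using sub ab(2) unfolding rel_def by blast
  moreover have "Z - {vset a b} \<in> Bic T" "Z - {vset a b} \<subset> Z"
    using c(1) unfolding bic_covers_def by auto
  ultimately have "W = Z - {vset a b}"
    using assms unfolding bic_covers_def by (metis psubsetI)
  then show thesis using that ab(1) by blast
qed

lemma inf_covers:
  assumes B: "B \<in> Bic T" and ne: "B \<noteq> {}"
  shows "\<Sqinter>\<^bsub>inclusion_order (Bic T)\<^esub> {B'. bic_covers T B' B} = ext (dcl_compl (rel B))"
proof -
  let ?L = "inclusion_order (Bic T)" and ?dcl_compl = "ext (dcl_compl (rel B))"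
  have BR: "biclosed (rel B)" "B \<subseteq> Seg T" using B Bic_iff by auto
  have MB: "biclosed (dcl_compl (rel B))" using biclosed_dcl_compl BR by blast
  have MBic: "?dcl_compl \<in> Bic T" using ext_Bic[OF MB] .
  have relM: "rel ?dcl_compl = dcl_compl (rel B)" using rel_ext biclosedD(1)[OF MB] by blast
  have Lower: "Lower ?L {B'. bic_covers T B' B} = {W \<in> Bic T. \<forall>B'. bic_covers T B' B \<longrightarrow> W \<subseteq> B'}"
    unfolding Lower_def inclusion_order_def bic_covers_def by auto
  have low: "?dcl_compl \<subseteq> B'" if c: "bic_covers T B' B" for B'
  proof -
    obtain a b where ab: "descent (rel B) a b" "B' = B - {vset a b}" using cover_descent[OF c] by blast
    have "dcl_compl (rel B) \<le> rel B'"
      using rel_remove[OF descent_cover(3)[OF B ab(1)]] ab cl.base[of "descent (rel B)"]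
        descent_sym[OF seg_rel_rel ab(1)]
      unfolding dcl_compl_def remove_def by auto
    then show ?thesis using subset_iff_rel[of ?dcl_compl B'] MBic relM unfolding Bic_iff by simp
  qed
  have great: "W \<subseteq> ?dcl_compl" if W: "W \<in> Bic T" "\<And>B'. bic_covers T B' B \<Longrightarrow> W \<subseteq> B'" for W
  proof -
    have WR: "biclosed (rel W)" using W Bic_iff by blast
    have d: "W \<subseteq> B - {vset a b}" if "descent (rel B) a b" for a b
      using W(2) descent_cover[OF B that] by blast
    \<comment> \<open>Comparing \<open>B\<close> with the empty biclosed set yields a descent, so
      \<open>B\<close> has at least one lower cover. This places every lower bound \<open>W\<close>
      inside \<open>B\<close>.\<close>
    have "biclosed (rel {})"
      unfolding biclosed_def closed_rel_def coclosed_rel_def using seg_rel_rel[of "{}"] by (simp add: rel_def)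
    moreover obtain a b where "rel B a b" using ne subset_iff_rel[OF BR(2), of "{}"] by blast
    ultimately obtain a b where "descent (rel B) a b"
      using exists_descent[OF BR(1), of "rel {}" a b] unfolding rel_def by auto
    then have "W \<subseteq> B" using d by blast
    then have "rel W \<le> rel B" using subset_iff_rel[of W B] W unfolding Bic_iff by blast
    moreover have "\<not> rel W a b" if "descent (rel B) a b" for a b
      using d[OF that] unfolding rel_def by blast
    ultimately have "rel W \<le> dcl_compl (rel B)" using dcl_compl_greatest[OF WR] by blast
    then show ?thesis using subset_iff_rel[of W ?dcl_compl] W relM unfolding Bic_iff by simp
  qed
  \<comment> \<open>The infimum is a choice among greatest lower bounds, so uniqueness is needed to
    evaluate it.\<close>
  have "greatest ?L g (Lower ?L {B'. bic_covers T B' B}) \<longleftrightarrow> g = ?dcl_compl" for g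
  proof
    assume "greatest ?L g (Lower ?L {B'. bic_covers T B' B})"
    then have "g \<in> Bic T" "\<And>B'. bic_covers T B' B \<Longrightarrow> g \<subseteq> B'" "?dcl_compl \<subseteq> g"
      unfolding greatest_def Lower using MBic low by (auto simp: inclusion_order_def)
    then show "g = ?dcl_compl" using great by blast
  qed (unfold greatest_def Lower, use MBic low great in \<open>auto simp: inclusion_order_def\<close>)
  then show ?thesis unfolding inf_def by simp
qed

text \<open>Explicit form of \<open>psi T B\<close>: \<open>D\<close> contains exactly one member of
  each break, and all of it lies in \<open>B\<close>.\<close>

definition labels :: "'a set set \<Rightarrow> ('a set \<times> 'a set set) set" where
  "labels B = {(vset a b, D) | a b D. dcl (rel B) a b \<and> D \<subseteq> B \<inter> splits T (vset a b) \<and>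
    (\<forall>v. btw a v b \<longrightarrow> (vset a v \<in> D \<longleftrightarrow> vset v b \<notin> D))}"

lemma psi_eq_labels:
  assumes B: "B \<in> Bic T" shows "psi T B = labels B"
proof (cases "B = {}")
  case True
  have "\<not> dcl (rel {}) a b" for a b
    using cl_least[of "descent (rel {})" a b "rel {}"] descents_le[of "rel {}"]
    by (auto simp: closed_rel_def rel_def)
  then show ?thesis using True unfolding psi_def labels_def by simp
next
  case False
  note inf = inf_covers[OF B False]
  have BR: "biclosed (rel B)" "B \<subseteq> Seg T" using B Bic_iff by auto
  have MB: "biclosed (dcl_compl (rel B))" using biclosed_dcl_compl BR by blast
  have relM: "rel (ext (dcl_compl (rel B))) = dcl_compl (rel B)" using rel_ext biclosedD(1)[OF MB] by blast
  show ?thesis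
  proof (intro equalityI subsetI)
    fix l assume "l \<in> psi T B"
    then obtain W Z where WZ: "l = cover_label T W Z" "ext (dcl_compl (rel B)) \<subseteq> W" "bic_covers T W Z" "Z \<subseteq> B"
      using False unfolding psi_def inf by auto
    have Z: "Z \<in> Bic T" "W \<subseteq> Z" using WZ(3) unfolding bic_covers_def by auto
    obtain a b where ab: "descent (rel Z) a b" "W = Z - {vset a b}" using cover_descent[OF WZ(3)] by blast
    note c = descent_cover[OF Z(1) ab(1)]
    have "Z - W = {vset a b}" using ab c by blast
    then have l: "l = (vset a b, splits T (vset a b) \<inter> W)" using WZ(1) by (simp add: cover_label_def Let_def)
    have "vset a b \<notin> ext (dcl_compl (rel B))" using WZ(2) ab(2) by blast
    then have "\<not> dcl_compl (rel B) a b" unfolding ext_def by blast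
    moreover have "rel B a b" using c WZ(4) unfolding rel_def by blast
    ultimately have "dcl (rel B) a b" unfolding dcl_compl_def by blast
    moreover have "vset a v \<in> splits T (vset a b) \<inter> W \<longleftrightarrow> vset v b \<notin> splits T (vset a b) \<inter> W"
      if v: "btw a v b" for v
    proof -
      have "vset a v \<in> W \<longleftrightarrow> rel Z a v" "vset v b \<in> W \<longleftrightarrow> rel Z v b"
        using ab(2) vset_btw_psubset[OF v] btw_seg_left[OF v] btw_seg_right[OF v]
        unfolding rel_def by auto
      moreover have "rel Z a v \<longleftrightarrow> \<not> rel Z v b"
        using ab(1) v coclosedD[OF biclosedD(3) v] Z(1) Bic_iff
        unfolding descent_def indec_def by blast
      moreover have "vset a v \<in> splits T (vset a b)" "vset v b \<in> splits T (vset a b)"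
        using splits_vset[OF c(3)] v by blast+
      ultimately show ?thesis by blast
    qed
    ultimately show "l \<in> labels B"
      unfolding labels_def l using Z(2) WZ(4) by blast
  next
    fix l assume "l \<in> labels B"
    then obtain a b D where l: "l = (vset a b, D)" and dcl: "dcl (rel B) a b"
      and D: "D \<subseteq> B \<inter> splits T (vset a b)"
      and br: "\<And>v. btw a v b \<Longrightarrow> vset a v \<in> D \<longleftrightarrow> vset v b \<notin> D"
      unfolding labels_def by auto
    \<comment> \<open>The vertices whose left piece is in \<open>D\<close> play the role of
      \<open>L\<close> in \<open>exists_cover_with_label\<close>.\<close>
    have "if v \<in> {v. vset a v \<in> D} then rel B a v else rel B v b" if v: "btw a v b" for v
      using br[OF v] D v btw_seg_left[OF v] btw_seg_right[OF v] unfolding rel_def by auto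
    then obtain R where R: "biclosed R" "dcl_compl (rel B) \<le> R" "R \<le> rel B" "descent R a b"
      "\<And>v. btw a v b \<Longrightarrow> (R a v \<longleftrightarrow> v \<in> {v. vset a v \<in> D}) \<and> (R v b \<longleftrightarrow> v \<notin> {v. vset a v \<in> D})"
      using exists_cover_with_label[OF BR(1) dcl] by blast
    define Z where "Z = ext R"
    have relZ: "rel Z = R" unfolding Z_def using rel_ext biclosedD(1)[OF R(1)] by blast
    have Z: "Z \<in> Bic T" unfolding Z_def using ext_Bic[OF R(1)] .
    have d: "descent (rel Z) a b" using R(4) relZ by simp
    define W where "W = Z - {vset a b}"
    note c = descent_cover[OF Z d]
    have "Z \<subseteq> B" using subset_iff_rel[of Z B] Z Bic_iff relZ R(3) by auto
    moreover have "ext (dcl_compl (rel B)) \<subseteq> W"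
    proof -
      have "ext (dcl_compl (rel B)) \<subseteq> Z" unfolding Z_def ext_def using R(2) by blast
      moreover have "vset a b \<notin> ext (dcl_compl (rel B))"
        using dcl c(3) fun_cong[OF fun_cong[OF relM], of a b] unfolding rel_def dcl_compl_def by blast
      ultimately show ?thesis unfolding W_def by blast
    qed
    moreover have "cover_label T W Z = l"
    proof -
      have "Z - W = {vset a b}" unfolding W_def using c by blast
      moreover have "splits T (vset a b) \<inter> W = D"
      proof -
        have v: "(vset a v \<in> W \<longleftrightarrow> vset a v \<in> D) \<and> (vset v b \<in> W \<longleftrightarrow> vset v b \<in> D)" if v: "btw a v b" for v
        proof -
          have "vset a v \<in> W \<longleftrightarrow> rel Z a v" "vset v b \<in> W \<longleftrightarrow> rel Z v b"
            using vset_btw_psubset[OF v] btw_seg_left[OF v] btw_seg_right[OF v]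
            unfolding rel_def W_def by auto
          then show ?thesis using R(5)[OF v] relZ br[OF v] by simp
        qed
        then have "t \<in> W \<longleftrightarrow> t \<in> D" if "t \<in> splits T (vset a b)" for t
          using that unfolding splits_vset[OF c(3)] by blast
        then show ?thesis using D by blast
      qed
      ultimately show ?thesis unfolding l cover_label_def Let_def by simp
    qed
    ultimately show "l \<in> psi T B"
      unfolding psi_def inf using False c(1) unfolding W_def by auto
  qed
qed

section \<open>Closure under intersection and the lattice\<close>

lemma labels_inter:
  assumes "B1 \<in> Bic T" "B2 \<in> Bic T"
  obtains B where "B \<in> Bic T" "labels B = labels B1 \<inter> labels B2"
proof -
  have B12: "biclosed (rel B1)" "biclosed (rel B2)" using assms Bic_iff by auto
  obtain R where R: "biclosed R" "R \<le> (\<lambda>a b. rel B1 a b \<and> rel B2 a b)"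
    "\<And>a b. dcl R a b \<longleftrightarrow> dcl (rel B1) a b \<and> dcl (rel B2) a b \<and>
      (\<forall>v. btw a v b \<longrightarrow> (rel B1 a v \<and> rel B2 a v) \<or> (rel B1 v b \<and> rel B2 v b))"
    "\<And>a b v. dcl R a b \<Longrightarrow> btw a v b \<Longrightarrow>
      ((rel B1 a v \<and> rel B2 a v) \<longrightarrow> R a v) \<and> ((rel B1 v b \<and> rel B2 v b) \<longrightarrow> R v b)"
    using label_intersection[OF B12] by blast
  define B where "B = ext R"
  have relB: "rel B = R" unfolding B_def using rel_ext biclosedD(1)[OF R(1)] by blast
  have B: "B \<in> Bic T" unfolding B_def using ext_Bic[OF R(1)] .
  have sub: "B \<subseteq> B1 \<inter> B2"
    using subset_iff_rel[of B B1] subset_iff_rel[of B B2] B Bic_iff relB R(2) by auto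
  have dcl_seg: "dcl (rel B') a b \<Longrightarrow> seg a b" if "biclosed (rel B')" for B' a b
    using dcl_le[OF that] unfolding rel_def by blast
  have dcl_sym: "dcl (rel B') a b \<Longrightarrow> dcl (rel B') b a" for B' a b
    using seg_relD(1)[OF seg_rel_dcl[OF seg_rel_rel]] .
  have "labels B = labels B1 \<inter> labels B2"
  proof (intro equalityI subsetI)
    fix l assume "l \<in> labels B"
    then obtain a b D where l: "l = (vset a b, D)" and dcl: "dcl R a b"
      and D: "D \<subseteq> B \<inter> splits T (vset a b)"
      and br: "\<forall>v. btw a v b \<longrightarrow> (vset a v \<in> D \<longleftrightarrow> vset v b \<notin> D)"
      unfolding labels_def relB by auto
    have "dcl (rel B1) a b" "dcl (rel B2) a b" using dcl R(3) by blast+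
    moreover have "D \<subseteq> B1 \<inter> splits T (vset a b)" "D \<subseteq> B2 \<inter> splits T (vset a b)" using D sub by blast+
    ultimately show "l \<in> labels B1 \<inter> labels B2" unfolding labels_def l using br by blast
  next
    fix l assume l12: "l \<in> labels B1 \<inter> labels B2"
    then obtain a b D where l: "l = (vset a b, D)" and C1: "dcl (rel B1) a b"
      and D1: "D \<subseteq> B1 \<inter> splits T (vset a b)"
      and br: "\<forall>v. btw a v b \<longrightarrow> (vset a v \<in> D \<longleftrightarrow> vset v b \<notin> D)"
      unfolding labels_def by auto
    obtain a' b' where ab': "vset a b = vset a' b'" and C2': "dcl (rel B2) a' b'"
      and D2: "D \<subseteq> B2 \<inter> splits T (vset a b)"
      using l12 unfolding labels_def l by auto
    have ab: "seg a b" using dcl_seg B12 C1 by blast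
    \<comment> \<open>The label may be presented in \<open>labels B2\<close> with its endpoints
      exchanged; \<open>vset_inj\<close> and symmetry realign them.\<close>
    have C2: "dcl (rel B2) a b" using vset_inj[OF ab dcl_seg[OF B12(2) C2']] ab' C2' dcl_sym by auto
    have "rel B1 a v \<and> rel B2 a v \<or> rel B1 v b \<and> rel B2 v b" if v: "btw a v b" for v
      using br v D1 D2 btw_seg_left[OF v] btw_seg_right[OF v] unfolding rel_def by blast
    then have dcl: "dcl R a b" using R(3) C1 C2 by blast
    have "D \<subseteq> B"
    proof
      fix t assume t: "t \<in> D"
      then obtain v where v: "btw a v b" "t = vset a v \<or> t = vset v b"
        using D1 splits_vset[OF ab] by blast
      then show "t \<in> B"
        using R(4)[OF dcl v(1)] t D1 D2 btw_seg_left[OF v(1)] btw_seg_right[OF v(1)] relB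
        unfolding rel_def by blast
    qed
    then show "l \<in> labels B" unfolding labels_def l relB using dcl D1 br by blast
  qed
  then show thesis using that B by blast
qed

lemma labels_subset_labels_Seg:
  assumes "B \<in> Bic T" shows "labels B \<subseteq> labels (Seg T)"
proof -
  have "rel (Seg T) = seg" unfolding rel_def Seg_iff fun_eq_iff by blast
  moreover have "seg a b" if "dcl (rel B) a b" for a b
    using dcl_le[OF _ that] assms unfolding Bic_iff by (simp add: rel_def)
  ultimately have "dcl (rel (Seg T)) a b" if "dcl (rel B) a b" for a b using that dcl_seg by simp
  then show ?thesis using assms unfolding labels_def Bic_iff by blast
qed

lemma Seg_Bic: "Seg T \<in> Bic T"
proof -
  have "rel (Seg T) = seg" unfolding rel_def Seg_iff fun_eq_iff by blast
  then show ?thesis using biclosed_seg unfolding Bic_iff by simp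
qed

lemma finite_Bic: "finite (Bic T)"
proof -
  have "Bic T \<subseteq> Pow (Pow (verts T))"
    unfolding Bic_def Seg_def seg_path_def walk_def by auto
  then show ?thesis using finite_verts finite_subset by blast
qed

end

text \<open>Meets are intersections. The join is the intersection of all common upper bounds, a
  finite family that is nonempty because it contains \<open>U\<close>.\<close>

lemma lattice_inclusion_orderI:
  assumes fin: "finite F" and top: "U \<in> F" "\<And>X. X \<in> F \<Longrightarrow> X \<subseteq> U"
    and inter: "\<And>X Y. X \<in> F \<Longrightarrow> Y \<in> F \<Longrightarrow> X \<inter> Y \<in> F"
  shows "lattice (inclusion_order F)"
proof -
  let ?L = "inclusion_order F"
  interpret partial_order ?L
    by unfold_locales (auto simp: inclusion_order_def)
  show ?thesis
  proof
    fix X Y assume "X \<in> carrier ?L" "Y \<in> carrier ?L"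
    then have XY: "X \<in> F" "Y \<in> F" by (auto simp: inclusion_order_def)
    let ?U = "{Z \<in> F. X \<subseteq> Z \<and> Y \<subseteq> Z}"
    have "\<Inter>G \<in> F" if "finite G" "G \<noteq> {}" "G \<subseteq> F" for G
      using that by (induction rule: finite_ne_induct) (auto intro: inter)
    moreover have "finite ?U" "?U \<noteq> {}" using fin top XY by auto
    ultimately have "\<Inter>?U \<in> F" by blast
    then have "least ?L (\<Inter>?U) (Upper ?L {X, Y})"
      using XY by (auto simp: least_def Upper_def inclusion_order_def)
    then show "\<exists>s. least ?L s (Upper ?L {X, Y})" by blast
    have "greatest ?L (X \<inter> Y) (Lower ?L {X, Y})"
      using XY inter[OF XY] by (auto simp: greatest_def Lower_def inclusion_order_def)
    then show "\<exists>s. greatest ?L s (Lower ?L {X, Y})" by blast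
  qed
qed

theorem theorem5p13:
  fixes T :: "'a ptree"
  assumes "embedded_tree T"
  shows "lattice (shard_intersection_order T)"
proof -
  interpret embedded_tree T by fact
  have psi: "psi T ` Bic T = labels ` Bic T" using psi_eq_labels by simp
  show ?thesis
    unfolding shard_intersection_order_def psi
  proof (rule lattice_inclusion_orderI)
    show "finite (labels ` Bic T)" using finite_Bic by simp
    show "labels (Seg T) \<in> labels ` Bic T" using Seg_Bic by simp
    show "\<And>X. X \<in> labels ` Bic T \<Longrightarrow> X \<subseteq> labels (Seg T)" using labels_subset_labels_Seg by blast
    fix X Y assume "X \<in> labels ` Bic T" "Y \<in> labels ` Bic T"
    then obtain B1 B2 where B: "B1 \<in> Bic T" "X = labels B1" "B2 \<in> Bic T" "Y = labels B2" by blast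
    obtain B where "B \<in> Bic T" "labels B = X \<inter> Y" using labels_inter[OF B(1,3)] B(2,4) by metis
    then show "X \<inter> Y \<in> labels ` Bic T" by (metis imageI)
  qed
qed

end
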